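(* Let \[ f(t,x):=\mathbb{E}\Big[\exp\Big(\int_t^T\sum_{i=1}^3u_i(s)p_i(X_s)ds+v(T)q(X_T)\Big)\,\Big|\,X_t=x\Big],\quad t\in[0,T],\ x\in\mathbb{R}. \] Then $f$ is $C^\infty$ in $x$, i.e. $\partial_x^kf$ exists and is continuous in $(t,x)$ for every $k\in\mathbb N$. Moreover, for each $k$ there exist a power series $q_k$ negligible to double factorial and a constant $C_k$ independent of $(t,x)$ such that \[ \Big|\frac{\partial^kf}{\partial x^k}(t,x)\Big|\le|q_k|(|x|)+C_k,\qquad t\in[0,T],\ x\in\mathbb{R}. \]
   Context: Let $W$ be a Brownian motion on a filtered probability space with usual conditions; $a,b\in\mathbb{R}$, $c\ne0$, $T>0$; $dX_t=(a+bX_t)dt+c\,dW_t$. A power series $p=\sum p_kx^k$ is negligible to double factorial if $\limsup_k(|p_k|(k-1)!!)^{1/k}=0$, $(-1)!!=0!!=1$. For a power series $q$, $|q|(x):=\sum_k|q_k|x^k$. Standing assumptions: $u_1,u_2,u_3,v:[0,T]\to\mathbb{C}$ are continuous with $\Re(u_1)\le0$ and $\Re(u_2)=\Re(u_3)=\Re(v)=0$; $p_1=p^2$ for a real-coefficient power series $p$ negligible to double factorial; $p_2,p_3,q$ are real-coefficient power series negligible to double factorial (so $p_1$ is too). *)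

theory Defs
  imports "HOL-Probability.Probability"
begin

text \<open>Power series with real coefficients are represented by their coefficient sequences.\<close>

definition ps_eval :: "(nat \<Rightarrow> real) \<Rightarrow> real \<Rightarrow> real" where
  "ps_eval p x = (\<Sum>k. p k * x ^ k)"

definition ps_abs_eval :: "(nat \<Rightarrow> real) \<Rightarrow> real \<Rightarrow> real" where
  "ps_abs_eval q x = (\<Sum>k. \<bar>q k\<bar> * x ^ k)"

definition ps_mult :: "(nat \<Rightarrow> real) \<Rightarrow> (nat \<Rightarrow> real) \<Rightarrow> nat \<Rightarrow> real" where
  "ps_mult p q k = (\<Sum>i\<le>k. p i * q (k - i))"

fun dfact :: "nat \<Rightarrow> nat" where
  "dfact 0 = 1"
| "dfact (Suc 0) = 1"
| "dfact (Suc (Suc n)) = Suc (Suc n) * dfact n"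

text \<open>(k-1)!! with the convention (-1)!! = 1 (nat subtraction gives dfact 0 = 1 for k = 0).\<close>
definition negligible_dfact :: "(nat \<Rightarrow> real) \<Rightarrow> bool" where
  "negligible_dfact p \<longleftrightarrow>
     limsup (\<lambda>k. ereal (root k (\<bar>p k\<bar> * real (dfact (k - 1))))) = 0"

definition usual_filtration :: "'a measure \<Rightarrow> (real \<Rightarrow> 'a set set) \<Rightarrow> bool" where
  "usual_filtration M F \<longleftrightarrow>
     (\<forall>t\<ge>0. sigma_algebra (space M) (F t) \<and> F t \<subseteq> sets M) \<and>
     (\<forall>s t. 0 \<le> s \<longrightarrow> s \<le> t \<longrightarrow> F s \<subseteq> F t) \<and>
     (\<forall>t\<ge>0. F t = (\<Inter>s\<in>{t<..}. F s)) \<and>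
     (\<forall>N. N \<subseteq> space M \<longrightarrow> (\<exists>A\<in>null_sets M. N \<subseteq> A) \<longrightarrow> N \<in> F 0)"

definition brownian_motion :: "'a measure \<Rightarrow> (real \<Rightarrow> 'a set set) \<Rightarrow> (real \<Rightarrow> 'a \<Rightarrow> real) \<Rightarrow> bool" where
  "brownian_motion M F W \<longleftrightarrow>
     prob_space M \<and> usual_filtration M F \<and>
     (\<forall>t\<ge>0. \<forall>B\<in>sets borel. W t -` B \<inter> space M \<in> F t) \<and>
     (AE \<omega> in M. W 0 \<omega> = 0) \<and>
     (AE \<omega> in M. continuous_on {0..} (\<lambda>t. W t \<omega>)) \<and>
     (\<forall>s t. 0 \<le> s \<longrightarrow> s < t \<longrightarrow>
        distributed M lborel (\<lambda>\<omega>. W t \<omega> - W s \<omega>) (normal_density 0 (sqrt (t - s)))) \<and>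
     (\<forall>s t. 0 \<le> s \<longrightarrow> s \<le> t \<longrightarrow> (\<forall>A\<in>F s. \<forall>B\<in>sets borel.
        measure M (A \<inter> {\<omega>\<in>space M. W t \<omega> - W s \<omega> \<in> B})
          = measure M A * measure M {\<omega>\<in>space M. W t \<omega> - W s \<omega> \<in> B}))"

fun xderiv :: "nat \<Rightarrow> (real \<Rightarrow> real \<Rightarrow> complex) \<Rightarrow> real \<Rightarrow> real \<Rightarrow> complex" where
  "xderiv 0 g = g"
| "xderiv (Suc k) g = (\<lambda>t x. vector_derivative (\<lambda>y. xderiv k g t y) (at x))"

end

theory Submission
  imports Defs
begin

text \<open>Let \<open>U\<close> solve the equation from time 0 and value 0. By linearity the solution started at time \<open>t\<close>
  in \<open>x\<close> is \<open>U s + exp (b (s - t)) (x - U t)\<close>, an affine function of \<open>x\<close>, so the \<open>k\<close>-th \<open>x\<close>-derivative of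
  the random exponential is that exponential, whose modulus is at most 1, times a polynomial in the
  derivatives of the exponent. All of these are dominated, uniformly in \<open>t\<close>, by a negligible power series
  in \<open>\<bar>x\<bar> + D\<close>, where \<open>D\<close> is affine in the supremum of \<open>\<bar>W\<bar>\<close> over \<open>[0, T]\<close>. By Levy's maximal inequality the
  moments of \<open>D\<close> grow at most like \<open>R ^ k (k - 1)!!\<close>, so such a series is integrable; dominated
  convergence gives differentiability and joint continuity, and \<open>(y + z) ^ k \<le> 2 ^ k (y ^ k + z ^ k)\<close>
  separates \<open>\<bar>x\<bar>\<close> from \<open>D\<close> in the bound.\<close>

section \<open>Negligible power series\<close>

text \<open>Domination cannot come from bounding the exponent: the exponential of a power series in
  a Gaussian variable need not be integrable. The sign conditions help instead: \<open>p1\<close> is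
  a square, hence nonnegative on the reals, so \<open>u1 * p1\<close> has real part at most 0, and
  the other terms are imaginary. Only a series in \<open>D\<close> remains to be integrated. The
  double factorial is the growth of the absolute moments of a normal variable: negligibility says
  that the coefficients times \<open>R ^ k (k - 1)!!\<close> stay bounded for every R, which is what
  taking expectations term by term needs. The class must also be stable under derivatives and
  products; for products this rests on
  \<open>(m + n - 1)!! \<le> 2 ^ (m + n) (m - 1)!! (n - 1)!!\<close>. The other obstacle is null
  sets. Each \<open>X t x\<close> solves its equation only almost surely, with an exceptional set
  depending on (t, x), so its dependence on x for a fixed outcome is uncontrolled. One process whose
  paths are all continuous replaces the whole family; as f looks at one pair (t, x) at a time, the
  exchange does not change it.\<close>

lemma dfact_ge_1: "1 \<le> dfact n"
  by (induction n rule: dfact.induct) auto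

lemma dfact_le_Suc: "dfact n \<le> dfact (Suc n)"
proof (induction n rule: dfact.induct)
  case (3 n)
  have "Suc (Suc n) * dfact n \<le> Suc (Suc (Suc n)) * dfact (Suc n)"
    using 3 by (intro mult_mono) auto
  then show ?case by simp
qed auto

lemma dfact_pred_mult: "dfact (k - 1) * dfact k = fact k"
proof (induction k rule: dfact.induct)
  case (3 n)
  then show ?case
    by (cases n) (auto simp: algebra_simps)
qed auto

lemma dfact_le_pred: "dfact k \<le> Suc k * dfact (k - 1)"
proof (cases k rule: dfact.cases)
  case (3 n)
  have "Suc (Suc n) * dfact n \<le> Suc (Suc (Suc n)) * dfact (Suc n)"
    using dfact_le_Suc[of n] by (intro mult_mono) auto
  then show ?thesis using 3 by simp
qed auto

lemma dfact_pred_le: "dfact (k - 1) \<le> dfact k"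
  using dfact_le_Suc[of "k - 1"] by (cases k) auto

lemma Suc_le_power2: "Suc k \<le> 2 ^ k"
  by (induction k) auto

text \<open>Since \<open>(k-1)!! k!! = k!\<close>, the square of \<open>(k-1)!!\<close> is \<open>k!\<close> up to a factor \<open>k + 1\<close>, and the
  claim reduces to \<open>m + n choose m \<le> 2 ^ (m + n)\<close>.\<close>
lemma dfact_pred_add: "dfact (m + n - 1) \<le> 2 ^ (m + n) * dfact (m - 1) * dfact (n - 1)"
proof -
  have upper: "fact k \<le> 2 ^ k * (dfact (k - 1))\<^sup>2" for k
  proof -
    have "fact k \<le> dfact (k - 1) * (Suc k * dfact (k - 1))"
      unfolding dfact_pred_mult[symmetric] by (intro mult_mono dfact_le_pred) auto
    also have "\<dots> = Suc k * (dfact (k - 1))\<^sup>2" by (simp add: power2_eq_square algebra_simps)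
    also have "\<dots> \<le> 2 ^ k * (dfact (k - 1))\<^sup>2" by (intro mult_mono Suc_le_power2) auto
    finally show ?thesis .
  qed
  have "(dfact (m + n - 1))\<^sup>2 \<le> dfact (m + n - 1) * dfact (m + n)"
    unfolding power2_eq_square by (intro mult_mono dfact_pred_le) auto
  also have "\<dots> = fact (m + n)" by (rule dfact_pred_mult)
  also have "\<dots> = ((m + n) choose m) * (fact m * fact n)"
    using binomial_fact_lemma[of m "m + n"] by (simp add: algebra_simps)
  also have "\<dots> \<le> 2 ^ (m + n) * ((2 ^ m * (dfact (m - 1))\<^sup>2) * (2 ^ n * (dfact (n - 1))\<^sup>2))"
  proof (intro mult_mono upper)
    show "((m + n) choose m) \<le> 2 ^ (m + n)"
      by (rule binomial_le_pow2)
  qed auto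
  also have "\<dots> = (2 ^ (m + n) * dfact (m - 1) * dfact (n - 1))\<^sup>2"
    by (simp add: power2_eq_square power_add algebra_simps)
  finally show ?thesis
    by (rule power2_le_imp_le) simp
qed

text \<open>The root test without roots: the limsup vanishes exactly when the weighted coefficients
  decay faster than every geometric sequence. Boundedness is enough on the right because R is
  arbitrary and can be enlarged. All closure properties below amount to choosing a larger R.\<close>

lemma negligible_dfact_iff:
  "negligible_dfact p \<longleftrightarrow> (\<forall>R>0. \<exists>C. \<forall>k. \<bar>p k\<bar> * real (dfact (k - 1)) * R ^ k \<le> C)"
proof
  assume neg: "negligible_dfact p"
  show "\<forall>R>0. \<exists>C. \<forall>k. \<bar>p k\<bar> * real (dfact (k - 1)) * R ^ k \<le> C"
  proof (intro allI impI)
    fix R :: real assume R: "R > 0"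
    have "Limsup sequentially (\<lambda>k. ereal (root k (\<bar>p k\<bar> * real (dfact (k - 1))))) < ereal (1 / R)"
      using neg R unfolding negligible_dfact_def by simp
    then have "\<forall>\<^sub>F k in sequentially. ereal (root k (\<bar>p k\<bar> * real (dfact (k - 1)))) < ereal (1 / R)"
      by (rule Limsup_lessD)
    then have "\<forall>\<^sub>F k in sequentially. norm (\<bar>p k\<bar> * real (dfact (k - 1)) * R ^ k) \<le> 1"
      \<comment> \<open>At \<open>k = 0\<close> the convention \<open>root 0 y = 0\<close> breaks
        the link between root and power.\<close>
      using eventually_gt_at_top[of 0]
    proof eventually_elim
      case (elim k)
      have "root k (\<bar>p k\<bar> * real (dfact (k - 1))) ^ k \<le> (1 / R) ^ k"
        using elim by (intro power_mono) auto
      then have "\<bar>p k\<bar> * real (dfact (k - 1)) \<le> 1 / R ^ k"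
        using elim by (simp add: power_one_over)
      then show ?case
        using R by (simp add: field_simps abs_mult)
    qed
    then have "Bseq (\<lambda>k. \<bar>p k\<bar> * real (dfact (k - 1)) * R ^ k)"
      by (rule BfunI)
    then obtain C where "norm (\<bar>p k\<bar> * real (dfact (k - 1)) * R ^ k) \<le> C" for k
      unfolding Bseq_def by blast
    then show "\<exists>C. \<forall>k. \<bar>p k\<bar> * real (dfact (k - 1)) * R ^ k \<le> C"
      by (metis abs_le_D1 real_norm_def)
  qed
next
  assume *: "\<forall>R>0. \<exists>C. \<forall>k. \<bar>p k\<bar> * real (dfact (k - 1)) * R ^ k \<le> C"
  have "(\<lambda>k. root k (\<bar>p k\<bar> * real (dfact (k - 1)))) \<longlonglongrightarrow> 0"
  proof (rule order_tendstoI)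
    fix l :: real assume l: "l < 0"
    show "\<forall>\<^sub>F k in sequentially. l < root k (\<bar>p k\<bar> * real (dfact (k - 1)))"
      by (intro always_eventually allI order.strict_trans2[OF l] real_root_ge_zero) auto
  next
    fix e :: real assume e: "e > 0"
    \<comment> \<open>The constant C is eventually below \<open>2 ^ k\<close>, so the root is at
      most \<open>2 / R\<close>, which is \<open>e / 2\<close>.\<close>
    define R where "R = 4 / e"
    have R: "R > 0" using e by (simp add: R_def)
    obtain C where C: "\<bar>p k\<bar> * real (dfact (k - 1)) * R ^ k \<le> C" for k using * R by blast
    obtain N where N: "C < 2 ^ N" using real_arch_pow[of 2 C] by auto
    show "\<forall>\<^sub>F k in sequentially. root k (\<bar>p k\<bar> * real (dfact (k - 1))) < e"
      using eventually_gt_at_top[of N]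
    proof eventually_elim
      case (elim k)
      have "(2::real) ^ N \<le> 2 ^ k" using elim by (intro power_increasing) auto
      then have "C \<le> 2 ^ k" using N by linarith
      then have "\<bar>p k\<bar> * real (dfact (k - 1)) * R ^ k \<le> 2 ^ k" using C[of k] by linarith
      then have "\<bar>p k\<bar> * real (dfact (k - 1)) \<le> (2 / R) ^ k"
        using R by (simp add: field_simps power_divide)
      then have "root k (\<bar>p k\<bar> * real (dfact (k - 1))) \<le> root k ((2 / R) ^ k)"
        using elim by simp
      also have "\<dots> = 2 / R" using elim R by (simp add: real_root_power_cancel)
      also have "\<dots> < e" using e by (simp add: R_def)
      finally show ?case .
    qed
  qed
  then have "(\<lambda>k. ereal (root k (\<bar>p k\<bar> * real (dfact (k - 1))))) \<longlonglongrightarrow> ereal 0"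
    by simp
  then show "negligible_dfact p"
    unfolding negligible_dfact_def by (subst lim_imp_Limsup) (auto simp: zero_ereal_def)
qed

section \<open>Closure of the negligible series under algebraic operations and
  differentiation\<close>

lemma negligible_dfactI:
  assumes "\<And>R. R > 0 \<Longrightarrow> \<exists>C. \<forall>k. \<bar>p k\<bar> * real (dfact (k - 1)) * R ^ k \<le> C"
  shows "negligible_dfact p"
  using assms by (simp add: negligible_dfact_iff)

lemma negligible_dfactE:
  assumes "negligible_dfact p" "R > 0"
  obtains C where "C \<ge> 0" "\<And>k. \<bar>p k\<bar> * real (dfact (k - 1)) * R ^ k \<le> C"
proof -
  obtain C where C: "\<And>k. \<bar>p k\<bar> * real (dfact (k - 1)) * R ^ k \<le> C"
    using assms by (auto simp: negligible_dfact_iff)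
  moreover have "0 \<le> C"
    using C[of 0] by (simp add: order_trans[OF abs_ge_zero])
  ultimately show ?thesis using that by blast
qed

lemma negligible_dfact_abs: "negligible_dfact p \<Longrightarrow> negligible_dfact (\<lambda>k. \<bar>p k\<bar>)"
  by (simp add: negligible_dfact_iff)

lemma negligible_dfact_finite:
  assumes "\<And>k. k \<ge> n \<Longrightarrow> p k = 0"
  shows "negligible_dfact p"
proof (rule negligible_dfactI)
  fix R :: real assume "R > 0"
  have "\<bar>p k\<bar> * real (dfact (k - 1)) * R ^ k \<le> (\<Sum>k<n. \<bar>p k\<bar> * real (dfact (k - 1)) * R ^ k)" for k
  proof (cases "k < n")
    case True
    then show ?thesis
      using \<open>R > 0\<close> by (intro member_le_sum) auto
  qed (use assms \<open>R > 0\<close> in \<open>auto intro!: sum_nonneg\<close>)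
  then show "\<exists>C. \<forall>k. \<bar>p k\<bar> * real (dfact (k - 1)) * R ^ k \<le> C" by blast
qed

lemma negligible_dfact_add:
  assumes "negligible_dfact p" "negligible_dfact q"
  shows "negligible_dfact (\<lambda>k. p k + q k)"
proof (rule negligible_dfactI)
  fix R :: real assume R: "R > 0"
  obtain C where C: "\<And>k. \<bar>p k\<bar> * real (dfact (k - 1)) * R ^ k \<le> C"
    using negligible_dfactE[OF assms(1) R] by blast
  obtain D where D: "\<And>k. \<bar>q k\<bar> * real (dfact (k - 1)) * R ^ k \<le> D"
    using negligible_dfactE[OF assms(2) R] by blast
  have "\<bar>p k + q k\<bar> * real (dfact (k - 1)) * R ^ k \<le> C + D" for k
  proof -
    have "\<bar>p k + q k\<bar> * real (dfact (k - 1)) * R ^ k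
        \<le> (\<bar>p k\<bar> + \<bar>q k\<bar>) * real (dfact (k - 1)) * R ^ k"
      using R by (intro mult_right_mono abs_triangle_ineq) auto
    also have "\<dots> \<le> C + D" using add_mono[OF C[of k] D[of k]] by (simp add: algebra_simps)
    finally show ?thesis .
  qed
  then show "\<exists>C. \<forall>k. \<bar>p k + q k\<bar> * real (dfact (k - 1)) * R ^ k \<le> C" by blast
qed

lemma negligible_dfact_cmult:
  assumes "negligible_dfact p"
  shows "negligible_dfact (\<lambda>k. m * p k)"
proof (rule negligible_dfactI)
  fix R :: real assume R: "R > 0"
  obtain C where C: "\<And>k. \<bar>p k\<bar> * real (dfact (k - 1)) * R ^ k \<le> C"
    using negligible_dfactE[OF assms R] by blast
  have "\<bar>m * p k\<bar> * real (dfact (k - 1)) * R ^ k \<le> \<bar>m\<bar> * C" for k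
    using mult_left_mono[OF C[of k], of "\<bar>m\<bar>"] by (simp add: abs_mult algebra_simps)
  then show "\<exists>C. \<forall>k. \<bar>m * p k\<bar> * real (dfact (k - 1)) * R ^ k \<le> C" by blast
qed

lemma negligible_dfact_scale:
  assumes "negligible_dfact p"
  shows "negligible_dfact (\<lambda>k. p k * m ^ k)"
proof (rule negligible_dfactI)
  fix R :: real assume R: "R > 0"
  \<comment> \<open>Adding 1 keeps the radius positive when \<open>m = 0\<close>.\<close>
  have "R * (\<bar>m\<bar> + 1) > 0" using R by simp
  then obtain C where C: "\<And>k. \<bar>p k\<bar> * real (dfact (k - 1)) * (R * (\<bar>m\<bar> + 1)) ^ k \<le> C"
    using negligible_dfactE[OF assms] by blast
  have "\<bar>p k * m ^ k\<bar> * real (dfact (k - 1)) * R ^ k \<le> C" for k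
  proof -
    have "\<bar>p k * m ^ k\<bar> * real (dfact (k - 1)) * R ^ k
        = \<bar>p k\<bar> * real (dfact (k - 1)) * (R ^ k * \<bar>m\<bar> ^ k)"
      by (simp add: abs_mult power_abs)
    also have "\<dots> \<le> \<bar>p k\<bar> * real (dfact (k - 1)) * (R ^ k * (\<bar>m\<bar> + 1) ^ k)"
      using R by (intro mult_left_mono power_mono) auto
    also have "\<dots> \<le> C" using C[of k] by (simp add: power_mult_distrib)
    finally show ?thesis .
  qed
  then show "\<exists>C. \<forall>k. \<bar>p k * m ^ k\<bar> * real (dfact (k - 1)) * R ^ k \<le> C" by blast
qed

text \<open>Differentiation shifts the index and brings in a factor \<open>k + 1\<close>. The shift
  only helps, as \<open>(k - 1)!! \<le> k!!\<close>, and the factor is at most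
  \<open>2 ^ (k + 1)\<close>, which doubling the radius pays for.\<close>

lemma negligible_dfact_diffs:
  assumes "negligible_dfact p"
  shows "negligible_dfact (diffs p)"
proof (rule negligible_dfactI)
  fix R :: real assume R: "R > 0"
  obtain C where C: "\<And>k. \<bar>p k\<bar> * real (dfact (k - 1)) * (2 * R) ^ k \<le> C"
    using negligible_dfactE[OF assms, of "2 * R"] R by auto
  have "\<bar>diffs p k\<bar> * real (dfact (k - 1)) * R ^ k \<le> C / R" for k
  proof -
    have "real (Suc k) \<le> 2 ^ Suc k"
      using Suc_le_power2[of "Suc k"] by (metis Suc_leD of_nat_le_iff of_nat_numeral of_nat_power)
    then have "\<bar>diffs p k\<bar> * real (dfact (k - 1)) * R ^ k
        \<le> (2 ^ Suc k * \<bar>p (Suc k)\<bar>) * real (dfact k) * R ^ k"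
      using R unfolding diffs_def
      by (intro mult_mono) (auto simp: abs_mult dfact_pred_le[simplified] intro!: mult_right_mono simp del: power_Suc)
    also have "\<dots> \<le> C / R" using C[of "Suc k"] R by (simp add: field_simps power_mult_distrib)
    finally show ?thesis .
  qed
  then show "\<exists>C. \<forall>k. \<bar>diffs p k\<bar> * real (dfact (k - 1)) * R ^ k \<le> C" by blast
qed

text \<open>The radius is multiplied by 4: one factor 2 pays for splitting the double factorial by
  \<open>dfact_pred_add\<close>, the other for the \<open>k + 1\<close> terms of the Cauchy
  product.\<close>

lemma negligible_dfact_mult:
  assumes "negligible_dfact p" "negligible_dfact q"
  shows "negligible_dfact (ps_mult p q)"
proof (rule negligible_dfactI)
  fix R :: real assume R: "R > 0"
  define e where "e k = real (dfact (k - 1))" for k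
  have e: "e k \<ge> 0" for k by (simp add: e_def)
  obtain C where C: "C \<ge> 0" "\<And>k. \<bar>p k\<bar> * e k * (4 * R) ^ k \<le> C"
    using negligible_dfactE[OF assms(1), of "4 * R"] R unfolding e_def by auto
  obtain D where D: "D \<ge> 0" "\<And>k. \<bar>q k\<bar> * e k * (4 * R) ^ k \<le> D"
    using negligible_dfactE[OF assms(2), of "4 * R"] R unfolding e_def by auto
  have "\<bar>ps_mult p q k\<bar> * e k * R ^ k \<le> C * D" for k
  proof -
    have summand: "\<bar>p i * q (k - i)\<bar> * e k * R ^ k \<le> C * D / 2 ^ k" if "i \<le> k" for i
    proof -
      have "e k \<le> 2 ^ k * e i * e (k - i)"
        using dfact_pred_add[of i "k - i"] that unfolding e_def
        by (metis (mono_tags, lifting) le_add_diff_inverse of_nat_le_iff of_nat_mult of_nat_numeral of_nat_power)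
      then have "\<bar>p i * q (k - i)\<bar> * e k * R ^ k
          \<le> \<bar>p i * q (k - i)\<bar> * (2 ^ k * e i * e (k - i)) * R ^ k"
        using R by (intro mult_right_mono mult_left_mono) auto
      also have "\<dots> = (\<bar>p i\<bar> * e i * (4 * R) ^ i) * (\<bar>q (k - i)\<bar> * e (k - i) * (4 * R) ^ (k - i)) / 2 ^ k"
      proof -
        have k: "z ^ k = z ^ i * z ^ (k - i)" for z :: real
          using that by (simp flip: power_add)
        have "(4::real) ^ k = 2 ^ k * 2 ^ k" by (simp flip: power_mult_distrib)
        then have "(2::real) ^ k * 2 ^ k = 4 ^ i * 4 ^ (k - i)" using k[of 4] by simp
        then show ?thesis by (simp add: k[of R] abs_mult power_mult_distrib field_simps)
      qed
      also have "\<dots> \<le> C * D / 2 ^ k"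
        using C D R e by (intro divide_right_mono mult_mono) auto
      finally show ?thesis .
    qed
    have "\<bar>ps_mult p q k\<bar> * e k * R ^ k \<le> (\<Sum>i\<le>k. \<bar>p i * q (k - i)\<bar>) * e k * R ^ k"
      unfolding ps_mult_def using R e by (intro mult_right_mono sum_abs) auto
    also have "\<dots> = (\<Sum>i\<le>k. \<bar>p i * q (k - i)\<bar> * e k * R ^ k)"
      by (simp add: sum_distrib_right)
    also have "\<dots> \<le> (\<Sum>i\<le>k. C * D / 2 ^ k)"
      using summand by (intro sum_mono) auto
    also have "\<dots> = (real (Suc k) / 2 ^ k) * (C * D)" by simp
    also have "\<dots> \<le> 1 * (C * D)"
    proof (intro mult_right_mono)
      have "real (Suc k) \<le> 2 ^ k"
        using Suc_le_power2[of k] by (metis of_nat_le_iff of_nat_numeral of_nat_power)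
      then show "real (Suc k) / 2 ^ k \<le> 1" by (simp add: field_simps)
    qed (use C D in auto)
    finally show ?thesis by simp
  qed
  then show "\<exists>C. \<forall>k. \<bar>ps_mult p q k\<bar> * real (dfact (k - 1)) * R ^ k \<le> C"
    unfolding e_def by blast
qed

text \<open>Doubling the radius gains a factor \<open>(1 / 2) ^ k\<close> and turns boundedness into
  geometric convergence. The double factorial stays in the series because it will be matched with
  the moments of the dominating variable.\<close>

lemma negligible_dfact_summable_abs:
  assumes "negligible_dfact p"
  shows "summable (\<lambda>k. \<bar>p k\<bar> * real (dfact (k - 1)) * \<bar>x\<bar> ^ k)"
proof -
  obtain C where C: "\<And>k. \<bar>p k\<bar> * real (dfact (k - 1)) * (2 * (\<bar>x\<bar> + 1)) ^ k \<le> C"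
    using negligible_dfactE[OF assms, of "2 * (\<bar>x\<bar> + 1)"] by (metis abs_ge_zero add_nonneg_pos mult_pos_pos zero_less_numeral zero_less_one)
  have "\<bar>p k\<bar> * real (dfact (k - 1)) * \<bar>x\<bar> ^ k \<le> C * (1 / 2) ^ k" for k
  proof -
    have "\<bar>p k\<bar> * real (dfact (k - 1)) * \<bar>x\<bar> ^ k \<le> \<bar>p k\<bar> * real (dfact (k - 1)) * (\<bar>x\<bar> + 1) ^ k"
      by (intro mult_left_mono power_mono) auto
    also have "\<dots> = \<bar>p k\<bar> * real (dfact (k - 1)) * (2 * (\<bar>x\<bar> + 1)) ^ k * (1 / 2) ^ k"
      by (simp add: power_mult_distrib power_one_over del: distrib_left_numeral)
    also have "\<dots> \<le> C * (1 / 2) ^ k"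
      using C[of k] by (intro mult_right_mono) auto
    finally show ?thesis .
  qed
  then show ?thesis
    by (intro summable_comparison_test'[OF summable_mult[OF summable_geometric[of "1 / 2"]],
          of 0 _ C]) auto
qed

section \<open>Negligible series as entire functions, and their majorants\<close>

lemma negligible_dfact_summable_norm:
  assumes "negligible_dfact p"
  shows "summable (\<lambda>k. norm (p k * x ^ k))"
proof (rule summable_comparison_test'[OF negligible_dfact_summable_abs[OF assms, of x], of 0])
  fix k
  have "\<bar>p k\<bar> * 1 * \<bar>x\<bar> ^ k \<le> \<bar>p k\<bar> * real (dfact (k - 1)) * \<bar>x\<bar> ^ k"
    using dfact_ge_1[of "k - 1"] by (intro mult_right_mono mult_left_mono) auto
  then show "norm (norm (p k * x ^ k)) \<le> \<bar>p k\<bar> * real (dfact (k - 1)) * \<bar>x\<bar> ^ k"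
    by (simp add: abs_mult power_abs)
qed

lemma negligible_dfact_summable: "negligible_dfact p \<Longrightarrow> summable (\<lambda>k. p k * x ^ k)"
  by (rule summable_norm_cancel[OF negligible_dfact_summable_norm])

lemma has_field_derivative_ps_eval:
  assumes "negligible_dfact p"
  shows "(ps_eval p has_field_derivative ps_eval (diffs p) x) (at x)"
  unfolding ps_eval_def
  by (rule termdiffs_strong_converges_everywhere) (rule negligible_dfact_summable[OF assms])

lemma continuous_on_ps_eval: "negligible_dfact p \<Longrightarrow> continuous_on A (ps_eval p)"
  by (meson DERIV_isCont continuous_at_imp_continuous_on has_field_derivative_ps_eval)

lemma ps_abs_eval_eq: "ps_abs_eval p = ps_eval (\<lambda>k. \<bar>p k\<bar>)"
  by (simp add: fun_eq_iff ps_abs_eval_def ps_eval_def)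

lemma summable_ps_abs_eval: "negligible_dfact p \<Longrightarrow> summable (\<lambda>k. \<bar>p k\<bar> * x ^ k)"
  by (rule negligible_dfact_summable[OF negligible_dfact_abs])

lemma continuous_on_ps_abs_eval: "negligible_dfact p \<Longrightarrow> continuous_on A (ps_abs_eval p)"
  by (simp add: ps_abs_eval_eq continuous_on_ps_eval negligible_dfact_abs)

lemma ps_abs_eval_nonneg: "negligible_dfact p \<Longrightarrow> 0 \<le> x \<Longrightarrow> 0 \<le> ps_abs_eval p x"
  unfolding ps_abs_eval_def by (intro suminf_nonneg summable_ps_abs_eval) auto

lemma ps_abs_eval_mono:
  assumes "negligible_dfact p" "0 \<le> x" "x \<le> y"
  shows "ps_abs_eval p x \<le> ps_abs_eval p y"
  unfolding ps_abs_eval_def using assms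
  by (intro suminf_le summable_ps_abs_eval mult_left_mono power_mono) auto

lemma abs_ps_eval_le:
  assumes "negligible_dfact p"
  shows "\<bar>ps_eval p x\<bar> \<le> ps_abs_eval p \<bar>x\<bar>"
  using summable_norm[OF negligible_dfact_summable_norm[OF assms, of x]]
  by (simp add: ps_eval_def ps_abs_eval_def abs_mult power_abs)

lemma ps_eval_mult:
  assumes "negligible_dfact p" "negligible_dfact q"
  shows "ps_eval (ps_mult p q) x = ps_eval p x * ps_eval q x"
proof -
  have "(\<Sum>k. p k * x ^ k) * (\<Sum>k. q k * x ^ k) = (\<Sum>k. \<Sum>i\<le>k. (p i * x ^ i) * (q (k - i) * x ^ (k - i)))"
    by (rule Cauchy_product) (rule negligible_dfact_summable_norm[OF assms(1)] negligible_dfact_summable_norm[OF assms(2)])+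
  also have "(\<lambda>k. \<Sum>i\<le>k. (p i * x ^ i) * (q (k - i) * x ^ (k - i))) = (\<lambda>k. ps_mult p q k * x ^ k)"
    unfolding ps_mult_def sum_distrib_right
  proof (intro ext sum.cong refl)
    fix k i :: nat assume "i \<in> {..k}"
    then have "x ^ k = x ^ i * x ^ (k - i)" by (simp flip: power_add)
    then show "(p i * x ^ i) * (q (k - i) * x ^ (k - i)) = p i * q (k - i) * x ^ k" by simp
  qed
  finally show ?thesis by (simp add: ps_eval_def)
qed

lemma ps_abs_eval_scale: "m \<ge> 0 \<Longrightarrow> ps_abs_eval (\<lambda>k. p k * m ^ k) x = ps_abs_eval p (m * x)"
  by (simp add: ps_abs_eval_def abs_mult power_mult_distrib mult.assoc)

lemma ps_abs_eval_cmult: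
  "negligible_dfact p \<Longrightarrow> ps_abs_eval (\<lambda>k. m * p k) x = \<bar>m\<bar> * ps_abs_eval p x"
  using suminf_mult[OF summable_ps_abs_eval, of p "\<bar>m\<bar>" x]
  by (simp add: ps_abs_eval_def abs_mult mult.assoc)

lemma ps_abs_eval_add:
  assumes "negligible_dfact p" "negligible_dfact q"
  shows "ps_abs_eval (\<lambda>k. \<bar>p k\<bar> + \<bar>q k\<bar>) x = ps_abs_eval p x + ps_abs_eval q x"
  using suminf_add[OF summable_ps_abs_eval[OF assms(1), of x] summable_ps_abs_eval[OF assms(2), of x]]
  by (simp add: ps_abs_eval_def distrib_right)

text \<open>The moduli are taken before multiplying: signed coefficients may cancel in the Cauchy
  product, and then the majorant of the product is smaller than the product of the
  majorants.\<close>

lemma ps_abs_eval_mult: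
  assumes "negligible_dfact p" "negligible_dfact q"
  shows "ps_abs_eval (ps_mult (\<lambda>k. \<bar>p k\<bar>) (\<lambda>k. \<bar>q k\<bar>)) x = ps_abs_eval p x * ps_abs_eval q x"
proof -
  have "\<bar>ps_mult (\<lambda>k. \<bar>p k\<bar>) (\<lambda>k. \<bar>q k\<bar>) k\<bar> = ps_mult (\<lambda>k. \<bar>p k\<bar>) (\<lambda>k. \<bar>q k\<bar>) k" for k
    unfolding ps_mult_def by (intro abs_of_nonneg sum_nonneg) auto
  then have "ps_abs_eval (ps_mult (\<lambda>k. \<bar>p k\<bar>) (\<lambda>k. \<bar>q k\<bar>)) x = ps_eval (ps_mult (\<lambda>k. \<bar>p k\<bar>) (\<lambda>k. \<bar>q k\<bar>)) x"
    unfolding ps_abs_eval_eq by simp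
  also have "\<dots> = ps_abs_eval p x * ps_abs_eval q x"
    unfolding ps_abs_eval_eq by (intro ps_eval_mult negligible_dfact_abs assms)
  finally show ?thesis .
qed

section \<open>The running maximum of Brownian motion\<close>

text \<open>Tonelli for the region \<open>0 \<le> l < f x\<close>. No sign condition is imposed on
  \<open>f\<close>, since \<open>ennreal\<close> cuts off negative values and the levels start at
  0.\<close>

lemma (in sigma_finite_measure) nn_integral_layer_cake:
  fixes f :: "'a \<Rightarrow> real"
  assumes [measurable]: "f \<in> borel_measurable M"
  shows "(\<integral>\<^sup>+x. ennreal (f x) \<partial>M)
    = (\<integral>\<^sup>+l. indicator {0..} l * emeasure M {x\<in>space M. l < f x} \<partial>lborel)"
proof -
  interpret pair_sigma_finite M lborel ..
  have "(\<integral>\<^sup>+x. ennreal (f x) \<partial>M) = (\<integral>\<^sup>+x. (\<integral>\<^sup>+l. indicator {(x, l). 0 \<le> l \<and> l < f x} (x, l) \<partial>lborel) \<partial>M)"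
  proof (rule nn_integral_cong)
    fix x
    have "(\<integral>\<^sup>+l. indicator {(x, l). 0 \<le> l \<and> l < f x} (x, l) \<partial>lborel) = (\<integral>\<^sup>+l. indicator {0..<f x} l \<partial>lborel)"
      by (intro nn_integral_cong) (auto simp: indicator_def)
    then show "ennreal (f x) = (\<integral>\<^sup>+l. indicator {(x, l). 0 \<le> l \<and> l < f x} (x, l) \<partial>lborel)"
      by (cases "0 \<le> f x") (auto simp: ennreal_neg)
  qed
  also have "\<dots> = (\<integral>\<^sup>+l. (\<integral>\<^sup>+x. indicator {(x, l). 0 \<le> l \<and> l < f x} (x, l) \<partial>M) \<partial>lborel)"
    by (rule Fubini'[symmetric]) measurable
  also have "\<dots> = (\<integral>\<^sup>+l. indicator {0..} l * emeasure M {x\<in>space M. l < f x} \<partial>lborel)"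
  proof (rule nn_integral_cong)
    fix l :: real
    have "(\<integral>\<^sup>+x. indicator {(x, l). 0 \<le> l \<and> l < f x} (x, l) \<partial>M)
        = (\<integral>\<^sup>+x. indicator {0..} l * indicator {x\<in>space M. l < f x} x \<partial>M)"
      by (intro nn_integral_cong) (auto simp: indicator_def)
    also have "\<dots> = indicator {0..} l * emeasure M {x\<in>space M. l < f x}"
      by (subst nn_integral_cmult) auto
    finally show "(\<integral>\<^sup>+x. indicator {(x, l). 0 \<le> l \<and> l < f x} (x, l) \<partial>M)
        = indicator {0..} l * emeasure M {x\<in>space M. l < f x}" .
  qed
  finally show ?thesis .
qed

lemma (in sigma_finite_measure) nn_integral_le_of_tail_le:
  fixes f g :: "'a \<Rightarrow> real"
  assumes [measurable]: "f \<in> borel_measurable M" "g \<in> borel_measurable M"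
    and tail: "\<And>l. 0 \<le> l \<Longrightarrow> emeasure M {x\<in>space M. l < f x} \<le> c * emeasure M {x\<in>space M. l < g x}"
  shows "(\<integral>\<^sup>+x. ennreal (f x) \<partial>M) \<le> c * (\<integral>\<^sup>+x. ennreal (g x) \<partial>M)"
proof -
  have "(\<integral>\<^sup>+l. indicator {0..} l * emeasure M {x\<in>space M. l < f x} \<partial>lborel)
      \<le> (\<integral>\<^sup>+l. c * (indicator {0..} l * emeasure M {x\<in>space M. l < g x}) \<partial>lborel)"
    using tail by (intro nn_integral_mono) (auto simp: indicator_def)
  also have "\<dots> = c * (\<integral>\<^sup>+l. indicator {0..} l * emeasure M {x\<in>space M. l < g x} \<partial>lborel)"
    by (rule nn_integral_cmult) measurable
  finally show ?thesis by (simp add: nn_integral_layer_cake)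
qed

text \<open>For a nonnegative function, exceeding l with the k-th power is exceeding
  \<open>root k l\<close> with the function itself, so a comparison of tails passes to all positive
  moments with the same constant.\<close>

lemma (in sigma_finite_measure) nn_integral_power_le_of_tail_le:
  fixes f g :: "'a \<Rightarrow> real"
  assumes [measurable]: "f \<in> borel_measurable M" "g \<in> borel_measurable M"
    and nonneg: "\<And>x. 0 \<le> f x" "\<And>x. 0 \<le> g x"
    and tail: "\<And>l. 0 \<le> l \<Longrightarrow> emeasure M {x\<in>space M. l < f x} \<le> c * emeasure M {x\<in>space M. l < g x}"
    and k: "0 < k"
  shows "(\<integral>\<^sup>+x. ennreal (f x ^ k) \<partial>M) \<le> c * (\<integral>\<^sup>+x. ennreal (g x ^ k) \<partial>M)"
proof (rule nn_integral_le_of_tail_le)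
  fix l :: real assume l: "0 \<le> l"
  have "l < y ^ k \<longleftrightarrow> root k l < y" if "0 \<le> y" for y
    using real_root_less_iff[OF k, of l "y ^ k"] real_root_power_cancel[OF k that] by simp
  then show "emeasure M {x\<in>space M. l < f x ^ k} \<le> c * emeasure M {x\<in>space M. l < g x ^ k}"
    using tail[of "root k l"] l k nonneg by (simp add: real_root_ge_zero)
qed measurable

section \<open>Moments and symmetry of the normal distribution\<close>

lemma dfact_even: "dfact (2 * j) = 2 ^ j * fact j"
  by (induction j) (auto simp: algebra_simps)

text \<open>For even k this is an equality; for odd k the exact moment carries the additional factor
  \<open>sqrt (2 / pi)\<close>, which is at most 1.\<close>

lemma normal_abs_moment_le:
  assumes "0 < \<sigma>"
  shows "(\<integral>\<^sup>+x. ennreal (normal_density 0 \<sigma> x) * ennreal (\<bar>x\<bar> ^ k) \<partial>lborel) \<le> ennreal (\<sigma> ^ k * real (dfact (k - 1)))"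
proof -
  have "(\<integral>\<^sup>+x. ennreal (normal_density 0 \<sigma> x) * ennreal (\<bar>x\<bar> ^ k) \<partial>lborel)
      = (\<integral>\<^sup>+x. ennreal (normal_density 0 \<sigma> x * \<bar>x\<bar> ^ k) \<partial>lborel)"
    by (simp add: ennreal_mult normal_density_nonneg)
  also have "\<dots> = ennreal (\<integral>x. normal_density 0 \<sigma> x * \<bar>x\<bar> ^ k \<partial>lborel)"
    using integrable_normal_moment_abs[OF assms, of 0 k]
    by (intro nn_integral_eq_integral) (auto intro!: AE_I2 mult_nonneg_nonneg normal_density_nonneg)
  also have "\<dots> \<le> ennreal (\<sigma> ^ k * real (dfact (k - 1)))"
  proof (rule ennreal_leI)
    show "(\<integral>x. normal_density 0 \<sigma> x * \<bar>x\<bar> ^ k \<partial>lborel) \<le> \<sigma> ^ k * real (dfact (k - 1))"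
    proof (cases "even k")
      case True
      then obtain j where j: "k = 2 * j" by (auto elim: evenE)
      have "real (dfact (k - 1)) * (2 ^ j * fact j) = fact (2 * j)"
        using arg_cong[OF dfact_pred_mult[of k], of real] by (simp add: j dfact_even)
      then have "real (dfact (k - 1)) = fact (2 * j) / (2 ^ j * fact j)"
        by (simp add: field_simps)
      moreover have "(\<integral>x. normal_density 0 \<sigma> x * \<bar>x\<bar> ^ k \<partial>lborel) = fact (2 * j) / ((2 / \<sigma>\<^sup>2) ^ j * fact j)"
        using integral_normal_moment_even[OF assms, of 0 j] by (simp add: j power_even_abs)
      ultimately show ?thesis
        using assms by (simp add: j power_divide power_mult[symmetric] mult.commute)
    next
      case False
      then obtain j where j: "k = 2 * j + 1" by (auto elim: oddE)
      have "(\<integral>x. normal_density 0 \<sigma> x * \<bar>x\<bar> ^ k \<partial>lborel) = (\<sigma> ^ k * real (dfact (k - 1))) * sqrt (2 / pi)"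
        using integral_normal_moment_abs_odd[OF assms, of 0 j] by (simp add: j dfact_even)
      also have "\<dots> \<le> (\<sigma> ^ k * real (dfact (k - 1))) * 1"
        using assms pi_gt3 by (intro mult_left_mono) auto
      finally show ?thesis by simp
    qed
  qed
  finally show ?thesis .
qed

text \<open>\<open>Y\<close> and \<open>- Y\<close> have the same law, so the two closed half-lines
  are equally likely, and together they cover the space.\<close>

lemma (in prob_space) normal_nonneg_prob_ge_half:
  assumes Y: "distributed M lborel Y (normal_density 0 \<sigma>)" and \<sigma>: "0 < \<sigma>"
  shows "1 / 2 \<le> prob {\<omega>\<in>space M. 0 \<le> Y \<omega>}" "1 / 2 \<le> prob {\<omega>\<in>space M. Y \<omega> \<le> 0}"
proof -
  have Ym[measurable]: "Y \<in> borel_measurable M"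
    using distributed_measurable[OF Y] by simp
  have nY: "distributed M lborel (\<lambda>\<omega>. - Y \<omega>) (normal_density 0 \<sigma>)"
    using normal_density_affine[OF Y \<sigma>, of "-1" 0] by simp
  have "distr M lborel Y = distr M lborel (\<lambda>\<omega>. - Y \<omega>)"
    using distributed_distr_eq_density[OF Y] distributed_distr_eq_density[OF nY] by simp
  then have "measure (distr M lborel Y) {0..} = measure (distr M lborel (\<lambda>\<omega>. - Y \<omega>)) {0..}"
    by simp
  then have eq: "prob {\<omega>\<in>space M. 0 \<le> Y \<omega>} = prob {\<omega>\<in>space M. Y \<omega> \<le> 0}"
    by (subst (asm) (1 2) measure_distr) (auto simp: vimage_def Int_def conj_commute)
  have "1 = prob ({\<omega>\<in>space M. 0 \<le> Y \<omega>} \<union> {\<omega>\<in>space M. Y \<omega> \<le> 0})"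
    using prob_space by (auto intro!: arg_cong[where f=prob] simp flip: prob_space)
  also have "\<dots> \<le> prob {\<omega>\<in>space M. 0 \<le> Y \<omega>} + prob {\<omega>\<in>space M. Y \<omega> \<le> 0}"
    by (rule measure_Un_le) measurable
  finally show "1 / 2 \<le> prob {\<omega>\<in>space M. 0 \<le> Y \<omega>}" "1 / 2 \<le> prob {\<omega>\<in>space M. Y \<omega> \<le> 0}"
    using eq by auto
qed

section \<open>The filtration, measurability of Brownian motion and its maximal inequality\<close>

lemma usual_filtrationD:
  assumes "usual_filtration M F" "0 \<le> s"
  shows "sigma_algebra (space M) (F s)" "F s \<subseteq> sets M" "s \<le> t \<Longrightarrow> F s \<subseteq> F t"
proof -
  note usual = assms(1)[unfolded usual_filtration_def]
  show "sigma_algebra (space M) (F s)" "F s \<subseteq> sets M"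
    using conjunct1[OF usual] assms(2) by auto
  show "s \<le> t \<Longrightarrow> F s \<subseteq> F t"
    using conjunct1[OF conjunct2[OF usual]] assms(2) by auto
qed

lemma usual_filtration_complete:
  assumes "usual_filtration M F" "A \<subseteq> space M" "\<exists>B\<in>null_sets M. A \<subseteq> B"
  shows "A \<in> sets M"
proof -
  note usual = assms(1)[unfolded usual_filtration_def]
  have "A \<in> F 0"
    using conjunct2[OF conjunct2[OF conjunct2[OF usual]]] assms(2,3) by blast
  then show ?thesis using usual_filtrationD(2)[OF assms(1) order_refl] by blast
qed

lemma brownian_motionD:
  assumes "brownian_motion M F W"
  shows "prob_space M" "usual_filtration M F" "AE \<omega> in M. W 0 \<omega> = 0"
    "AE \<omega> in M. continuous_on {0..} (\<lambda>t. W t \<omega>)"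
  using assms unfolding brownian_motion_def by simp_all

text \<open>\<open>F s\<close> is a bare family of sets. Wrapped by \<open>sigma\<close> it becomes
  a measurable space, so that events known at time s can be handled with the library's rules for
  measurable functions.\<close>

lemma brownian_motion_measurable_filtration:
  assumes "brownian_motion M F W" "0 \<le> r" "r \<le> s"
  shows "W r \<in> borel_measurable (sigma (space M) (F s))" "sets (sigma (space M) (F s)) = F s"
proof -
  have sa: "sigma_algebra (space M) (F s)" and "F r \<subseteq> F s"
    using usual_filtrationD[OF brownian_motionD(2)[OF assms(1)]] assms(2,3) by auto
  show sets: "sets (sigma (space M) (F s)) = F s"
    by (rule sigma_algebra.sets_measure_of_eq[OF sa])
  show "W r \<in> borel_measurable (sigma (space M) (F s))"
  proof (rule measurableI)
    fix B :: "real set" assume "B \<in> sets borel"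
    then have "W r -` B \<inter> space M \<in> F r"
      using assms(1,2) unfolding brownian_motion_def by blast
    then show "W r -` B \<inter> space (sigma (space M) (F s)) \<in> sets (sigma (space M) (F s))"
      using sets \<open>F r \<subseteq> F s\<close> by (auto simp: space_measure_of_conv)
  qed auto
qed

lemma brownian_motion_borel_measurable:
  assumes "brownian_motion M F W" "0 \<le> s"
  shows "W s \<in> borel_measurable M"
proof -
  have "F s \<subseteq> sets M"
    by (rule usual_filtrationD(2)[OF brownian_motionD(2)[OF assms(1)] assms(2)])
  then have "sets (sigma (space M) (F s)) \<subseteq> sets M"
    using brownian_motion_measurable_filtration(2)[OF assms(1,2) order_refl] by simp
  then show ?thesis
    using brownian_motion_measurable_filtration(1)[OF assms(1,2) order_refl]
    by (intro measurable_from_subalg[of M "sigma (space M) (F s)"])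
      (auto simp: subalgebra_def space_measure_of_conv)
qed

lemma brownian_motion_increment_half:
  assumes BM: "brownian_motion M F W" and s: "0 \<le> s" "s \<le> T"
  shows "1 / 2 \<le> measure M {\<omega>\<in>space M. W T \<omega> - W s \<omega> \<in> {0..}}"
    "1 / 2 \<le> measure M {\<omega>\<in>space M. W T \<omega> - W s \<omega> \<in> {..0}}"
proof -
  interpret prob_space M by (rule brownian_motionD(1)[OF BM])
  have "1 / 2 \<le> prob {\<omega>\<in>space M. W T \<omega> - W s \<omega> \<in> {0..}} \<and> 1 / 2 \<le> prob {\<omega>\<in>space M. W T \<omega> - W s \<omega> \<in> {..0}}"
  \<comment> \<open>A normal density is available only for increments over a nontrivial interval; at
    \<open>s = T\<close> the increment is 0 and both events are certain.\<close>
  proof (cases "s = T")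
    case True
    then show ?thesis by (simp add: prob_space)
  next
    case False
    then have "distributed M lborel (\<lambda>\<omega>. W T \<omega> - W s \<omega>) (normal_density 0 (sqrt (T - s)))"
      using BM s unfolding brownian_motion_def by (metis order_neq_le_trans)
    from normal_nonneg_prob_ge_half[OF this] False s show ?thesis by simp
  qed
  then show "1 / 2 \<le> measure M {\<omega>\<in>space M. W T \<omega> - W s \<omega> \<in> {0..}}"
    "1 / 2 \<le> measure M {\<omega>\<in>space M. W T \<omega> - W s \<omega> \<in> {..0}}" by auto
qed

text \<open>Decompose according to the first time \<open>s \<in> J\<close> at which \<open>\<bar>W s\<bar>\<close> exceeds \<open>l\<close>: with conditional
  probability at least one half the remaining increment does not bring \<open>\<bar>W\<bar>\<close> back below \<open>l\<close>.\<close>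
lemma brownian_motion_levy_inequality:
  assumes BM: "brownian_motion M F W" and J: "finite J" "J \<subseteq> {0..T}" and l: "0 \<le> l"
  shows "measure M {\<omega>\<in>space M. \<exists>s\<in>J. l < \<bar>W s \<omega>\<bar>} \<le> 2 * measure M {\<omega>\<in>space M. l < \<bar>W T \<omega>\<bar>}"
proof (cases "J = {}")
  case False
  interpret prob_space M by (rule brownian_motionD(1)[OF BM])
  have T: "0 \<le> T" using J False by fastforce
  have Wm: "W s \<in> borel_measurable M" if "s \<in> J" for s
    using brownian_motion_borel_measurable[OF BM] that J by auto
  have [measurable]: "W T \<in> borel_measurable M"
    using brownian_motion_borel_measurable[OF BM T] .
  define A where "A s = {\<omega>\<in>space M. l < \<bar>W s \<omega>\<bar> \<and> (\<forall>r\<in>J. r < s \<longrightarrow> \<bar>W r \<omega>\<bar> \<le> l)}" for s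
  define E where "E = {\<omega>\<in>space M. l < \<bar>W T \<omega>\<bar>}"
  have E[measurable]: "E \<in> sets M" unfolding E_def by measurable
  have half: "prob (A s) \<le> 2 * prob (A s \<inter> E)" and A_sets: "A s \<in> sets M" if s: "s \<in> J" for s
  proof -
    have s0: "0 \<le> s" "s \<le> T" using s J by auto
    define N where "N = sigma (space M) (F s)"
    have sets_N: "sets N = F s" and space_N: "space N = space M"
      using brownian_motion_measurable_filtration(2)[OF BM s0(1) order_refl] by (auto simp: N_def space_measure_of_conv)
    have W_N: "W r \<in> borel_measurable N" if "0 \<le> r" "r \<le> s" for r
      using brownian_motion_measurable_filtration(1)[OF BM that] by (simp add: N_def)
    have [measurable]: "W s \<in> borel_measurable N" using W_N s0 by simp
    have FM: "F s \<subseteq> sets M" by (rule usual_filtrationD(2)[OF brownian_motionD(2)[OF BM] s0(1)])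
    define J' where "J' = {r\<in>J. r < s}"
    have J': "finite J'" "\<And>r. r \<in> J' \<Longrightarrow> W r \<in> borel_measurable N"
      using J W_N by (auto simp: J'_def)
    have "{\<omega>\<in>space N. \<forall>r\<in>J'. \<bar>W r \<omega>\<bar> \<le> l} \<in> sets N"
      using J' by (intro sets.sets_Collect_finite_All) auto
    then have A0: "{\<omega>\<in>space N. P (W s \<omega>)} \<inter> {\<omega>\<in>space N. \<forall>r\<in>J'. \<bar>W r \<omega>\<bar> \<le> l} \<in> sets N"
      if "Measurable.pred borel P" for P using that by measurable
    \<comment> \<open>The sign of \<open>W s\<close> decides which half-line of increments keeps
      \<open>W T\<close> beyond l, so \<open>A s\<close> is split by sign; the parts are disjoint
      because \<open>0 \<le> l\<close>.\<close>
    define Ap where "Ap = {\<omega>\<in>space N. l < W s \<omega>} \<inter> {\<omega>\<in>space N. \<forall>r\<in>J'. \<bar>W r \<omega>\<bar> \<le> l}"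
    define An where "An = {\<omega>\<in>space N. W s \<omega> < - l} \<inter> {\<omega>\<in>space N. \<forall>r\<in>J'. \<bar>W r \<omega>\<bar> \<le> l}"
    have Ap_F: "Ap \<in> F s" and An_F: "An \<in> F s"
      unfolding Ap_def An_def sets_N[symmetric] by (intro A0; measurable)+
    then have ApM[measurable]: "Ap \<in> sets M" and AnM[measurable]: "An \<in> sets M" using FM by auto
    have A_eq: "A s = Ap \<union> An" and disj: "Ap \<inter> An = {}"
      using l by (auto simp: A_def Ap_def An_def space_N J'_def)
    show "A s \<in> sets M" unfolding A_eq by measurable
    have [measurable]: "W s \<in> borel_measurable M" using Wm s .
    have indep: "prob (B \<inter> {\<omega>\<in>space M. W T \<omega> - W s \<omega> \<in> C}) = prob B * prob {\<omega>\<in>space M. W T \<omega> - W s \<omega> \<in> C}"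
      if "B \<in> F s" "C \<in> sets borel" for B C
      using BM s0 that unfolding brownian_motion_def by blast
    have "prob Ap * (1 / 2) \<le> prob Ap * prob {\<omega>\<in>space M. W T \<omega> - W s \<omega> \<in> {0..}}"
      using brownian_motion_increment_half(1)[OF BM s0] by (intro mult_left_mono) auto
    also have "\<dots> = prob (Ap \<inter> {\<omega>\<in>space M. W T \<omega> - W s \<omega> \<in> {0..}})"
      by (rule indep[symmetric, OF Ap_F]) simp
    also have "\<dots> \<le> prob (Ap \<inter> E)"
      by (intro finite_measure_mono sets.Int ApM E) (auto simp: Ap_def E_def)
    finally have p: "prob Ap \<le> 2 * prob (Ap \<inter> E)" by simp
    have "prob An * (1 / 2) \<le> prob An * prob {\<omega>\<in>space M. W T \<omega> - W s \<omega> \<in> {..0}}"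
      using brownian_motion_increment_half(2)[OF BM s0] by (intro mult_left_mono) auto
    also have "\<dots> = prob (An \<inter> {\<omega>\<in>space M. W T \<omega> - W s \<omega> \<in> {..0}})"
      by (rule indep[symmetric, OF An_F]) simp
    also have "\<dots> \<le> prob (An \<inter> E)"
      by (intro finite_measure_mono sets.Int AnM E) (auto simp: An_def E_def)
    finally have n: "prob An \<le> 2 * prob (An \<inter> E)" by simp
    have "prob (A s) = prob Ap + prob An"
      unfolding A_eq by (rule finite_measure_Union) (use disj in auto)
    also have "\<dots> \<le> 2 * (prob (Ap \<inter> E) + prob (An \<inter> E))" using p n by simp
    also have "prob (Ap \<inter> E) + prob (An \<inter> E) = prob ((Ap \<inter> E) \<union> (An \<inter> E))"
      by (rule finite_measure_Union[symmetric]) (use disj in auto)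
    also have "(Ap \<inter> E) \<union> (An \<inter> E) = A s \<inter> E" by (auto simp: A_eq)
    finally show "prob (A s) \<le> 2 * prob (A s \<inter> E)" .
  qed
  have disj: "disjoint_family_on A J"
    unfolding disjoint_family_on_def A_def by (auto simp: not_less[symmetric] dest: linorder_neqE)
  have first: "{\<omega>\<in>space M. \<exists>s\<in>J. l < \<bar>W s \<omega>\<bar>} = (\<Union>s\<in>J. A s)"
  proof (intro equalityI subsetI)
    fix \<omega> assume \<omega>: "\<omega> \<in> {\<omega>\<in>space M. \<exists>s\<in>J. l < \<bar>W s \<omega>\<bar>}"
    define s where "s = Min {s\<in>J. l < \<bar>W s \<omega>\<bar>}"
    have fin: "finite {s\<in>J. l < \<bar>W s \<omega>\<bar>}" and ne: "{s\<in>J. l < \<bar>W s \<omega>\<bar>} \<noteq> {}" using J \<omega> by auto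
    have "s \<in> {s\<in>J. l < \<bar>W s \<omega>\<bar>}" unfolding s_def by (rule Min_in[OF fin ne])
    moreover have "\<bar>W r \<omega>\<bar> \<le> l" if "r \<in> J" "r < s" for r
      using Min_le[OF fin, of r] that unfolding s_def by fastforce
    ultimately show "\<omega> \<in> (\<Union>s\<in>J. A s)" using \<omega> by (auto simp: A_def)
  qed (auto simp: A_def)
  have "prob (\<Union>s\<in>J. A s) = (\<Sum>s\<in>J. prob (A s))"
    using A_sets by (intro finite_measure_finite_Union J disj) auto
  also have "\<dots> \<le> (\<Sum>s\<in>J. 2 * prob (A s \<inter> E))"
    by (intro sum_mono half)
  also have "\<dots> = 2 * prob (\<Union>s\<in>J. A s \<inter> E)"
    using A_sets disj
    by (subst finite_measure_finite_Union[OF J(1)])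
      (auto simp: sum_distrib_left disjoint_family_on_def)
  also have "\<dots> \<le> 2 * prob E"
    by (intro mult_left_mono finite_measure_mono) auto
  finally show ?thesis unfolding first E_def .
qed simp

text \<open>The supremum is taken over a countable dense set of times, hence is measurable, and
  continuity of the paths carries the bound to all of \<open>{0..T}\<close>. Levy's inequality on
  finite subsets passes to the countable set along increasing events and compares the tail of
  \<open>S\<close> with that of \<open>\<bar>W T\<bar>\<close>; the layer cake formula turns this
  into moments, and the factor 2 is the one of Levy's inequality.\<close>

lemma brownian_motion_sup_moments:
  assumes BM: "brownian_motion M F W" and T: "0 < T"
  obtains S where "S \<in> borel_measurable M" "\<And>\<omega>. 0 \<le> S \<omega>"
    "AE \<omega> in M. \<forall>s\<in>{0..T}. \<bar>W s \<omega>\<bar> \<le> S \<omega>"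
    "\<And>k. integrable M (\<lambda>\<omega>. S \<omega> ^ k)"
    "\<And>k. (\<integral>\<omega>. S \<omega> ^ k \<partial>M) \<le> 2 * (sqrt T ^ k * real (dfact (k - 1)))"
proof -
  interpret prob_space M by (rule brownian_motionD(1)[OF BM])
  obtain Q where Q: "countable Q" "Q \<subseteq> {0..T}" "{0..T} \<subseteq> closure Q"
    using separable[of "{0..T}"] by blast
  have Q_ne: "Q \<noteq> {}" using Q(3) T by force
  define d where "d = from_nat_into Q"
  have d: "range d = Q" unfolding d_def by (rule range_from_nat_into[OF Q_ne Q(1)])
  have d0: "0 \<le> d i" "d i \<in> {0..T}" for i using d Q(2) by (metis atLeastAtMost_iff rangeI subsetD)+
  have [measurable]: "W (d i) \<in> borel_measurable M" for i
    using brownian_motion_borel_measurable[OF BM d0(1)] .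
  have [measurable]: "W T \<in> borel_measurable M"
    using brownian_motion_borel_measurable[OF BM] T by simp
  \<comment> \<open>\<open>enn2real\<close> sends an infinite supremum to 0. This happens only on
    discontinuous paths, hence on a null set.\<close>
  define S where "S \<omega> = enn2real (SUP i. ennreal \<bar>W (d i) \<omega>\<bar>)" for \<omega>
  have Sm[measurable]: "S \<in> borel_measurable M" unfolding S_def by measurable
  have S0: "0 \<le> S \<omega>" for \<omega> by (simp add: S_def)
  have bound: "AE \<omega> in M. \<forall>s\<in>{0..T}. \<bar>W s \<omega>\<bar> \<le> S \<omega>"
  proof -
    have "AE \<omega> in M. continuous_on {0..} (\<lambda>t. W t \<omega>)"
      by (rule brownian_motionD(4)[OF BM])
    then show ?thesis
    proof eventually_elim
      case (elim \<omega>)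
      have c: "continuous_on {0..T} (\<lambda>t. \<bar>W t \<omega>\<bar>)"
        by (intro continuous_on_rabs continuous_on_subset[OF elim]) auto
      then have "bounded ((\<lambda>t. \<bar>W t \<omega>\<bar>) ` {0..T})"
        by (intro compact_imp_bounded compact_continuous_image) auto
      then obtain B where B: "\<And>s. s \<in> {0..T} \<Longrightarrow> \<bar>W s \<omega>\<bar> \<le> B"
        unfolding bounded_iff by (auto simp del: atLeastAtMost_iff)
      have "(SUP i. ennreal \<bar>W (d i) \<omega>\<bar>) \<le> ennreal B"
        using B d0(2) by (intro SUP_least ennreal_leI) auto
      then have fin: "(SUP i. ennreal \<bar>W (d i) \<omega>\<bar>) < top"
        by (rule order.strict_trans1) simp
      have "\<bar>W s \<omega>\<bar> \<le> S \<omega>" if "s \<in> Q" for s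
      proof -
        from that d obtain i where i: "s = d i" by auto
        have "ennreal \<bar>W (d i) \<omega>\<bar> \<le> (SUP i. ennreal \<bar>W (d i) \<omega>\<bar>)" by (rule SUP_upper) simp
        then have "enn2real (ennreal \<bar>W (d i) \<omega>\<bar>) \<le> S \<omega>"
          unfolding S_def using fin by (intro enn2real_mono)
        then show ?thesis by (simp add: i)
      qed
      moreover have "closure Q = {0..T}"
        using Q closure_minimal[OF Q(2)] by auto
      ultimately show ?case
        using continuous_le_on_closure[of Q "\<lambda>t. \<bar>W t \<omega>\<bar>" _ "S \<omega>"] c by auto
    qed
  qed
  have tail: "emeasure M {\<omega>\<in>space M. l < S \<omega>} \<le> 2 * emeasure M {\<omega>\<in>space M. l < \<bar>W T \<omega>\<bar>}" if l: "0 \<le> l" for l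
  proof -
    define B where "B n = {\<omega>\<in>space M. \<exists>s\<in>d ` {..n}. l < \<bar>W s \<omega>\<bar>}" for n :: nat
    have Bm[measurable]: "B n \<in> sets M" for n
    proof -
      have "B n = (\<Union>i\<le>n. {\<omega>\<in>space M. l < \<bar>W (d i) \<omega>\<bar>})" by (auto simp: B_def)
      then show ?thesis by simp
    qed
    have "{\<omega>\<in>space M. l < S \<omega>} \<subseteq> (\<Union>n. B n)"
    proof
      fix \<omega> assume \<omega>: "\<omega> \<in> {\<omega>\<in>space M. l < S \<omega>}"
      have "ennreal l < (SUP i. ennreal \<bar>W (d i) \<omega>\<bar>)"
      proof (rule ccontr)
        assume "\<not> ennreal l < (SUP i. ennreal \<bar>W (d i) \<omega>\<bar>)"
        then have "S \<omega> \<le> enn2real (ennreal l)"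
          unfolding S_def by (intro enn2real_mono) auto
        then show False using \<omega> l by simp
      qed
      then obtain i where "ennreal l < ennreal \<bar>W (d i) \<omega>\<bar>" by (auto simp: less_SUP_iff)
      then have "l < \<bar>W (d i) \<omega>\<bar>" using l by (simp add: ennreal_less_iff)
      then show "\<omega> \<in> (\<Union>n. B n)" using \<omega> by (auto simp: B_def)
    qed
    then have "emeasure M {\<omega>\<in>space M. l < S \<omega>} \<le> emeasure M (\<Union>n. B n)"
      by (rule emeasure_mono) measurable
    also have "\<dots> = (SUP n. emeasure M (B n))"
    proof (rule SUP_emeasure_incseq[symmetric])
      show "incseq B" unfolding incseq_def B_def by fastforce
    qed auto
    also have "\<dots> \<le> 2 * emeasure M {\<omega>\<in>space M. l < \<bar>W T \<omega>\<bar>}"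
    proof (rule SUP_least)
      fix n
      have "measure M (B n) \<le> 2 * measure M {\<omega>\<in>space M. l < \<bar>W T \<omega>\<bar>}"
        unfolding B_def using d0 by (intro brownian_motion_levy_inequality[OF BM _ _ l]) auto
      then have "ennreal (measure M (B n)) \<le> ennreal 2 * ennreal (measure M {\<omega>\<in>space M. l < \<bar>W T \<omega>\<bar>})"
        by (subst ennreal_mult[symmetric]) (auto intro: ennreal_leI)
      then show "emeasure M (B n) \<le> 2 * emeasure M {\<omega>\<in>space M. l < \<bar>W T \<omega>\<bar>}"
        by (simp add: emeasure_eq_measure)
    qed
    finally show ?thesis .
  qed
  have WT: "(\<integral>\<^sup>+\<omega>. ennreal (\<bar>W T \<omega>\<bar> ^ k) \<partial>M) \<le> ennreal (sqrt T ^ k * real (dfact (k - 1)))" for k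
  proof -
    have "distributed M lborel (\<lambda>\<omega>. W T \<omega> - W 0 \<omega>) (normal_density 0 (sqrt (T - 0)))"
      using BM T unfolding brownian_motion_def by blast
    then have dis: "distributed M lborel (\<lambda>\<omega>. W T \<omega> - W 0 \<omega>) (normal_density 0 (sqrt T))" by simp
    have "AE \<omega> in M. W 0 \<omega> = 0" by (rule brownian_motionD(3)[OF BM])
    then have "(\<integral>\<^sup>+\<omega>. ennreal (\<bar>W T \<omega>\<bar> ^ k) \<partial>M) = (\<integral>\<^sup>+\<omega>. ennreal (\<bar>W T \<omega> - W 0 \<omega>\<bar> ^ k) \<partial>M)"
      by (intro nn_integral_cong_AE) auto
    also have "\<dots> = (\<integral>\<^sup>+x. ennreal (normal_density 0 (sqrt T) x) * ennreal (\<bar>x\<bar> ^ k) \<partial>lborel)"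
      by (rule distributed_nn_integral[OF dis, symmetric]) measurable
    also have "\<dots> \<le> ennreal (sqrt T ^ k * real (dfact (k - 1)))"
      using T by (intro normal_abs_moment_le) simp
    finally show ?thesis .
  qed
  have nn: "(\<integral>\<^sup>+\<omega>. ennreal (S \<omega> ^ k) \<partial>M) \<le> ennreal (2 * (sqrt T ^ k * real (dfact (k - 1))))" for k
  \<comment> \<open>The comparison of moments requires \<open>0 < k\<close>; for
    \<open>k = 0\<close> the integral is 1 and the bound is 2.\<close>
  proof (cases "k = 0")
    case True
    then show ?thesis by (simp add: emeasure_space_1)
  next
    case False
    then have "(\<integral>\<^sup>+\<omega>. ennreal (S \<omega> ^ k) \<partial>M) \<le> 2 * (\<integral>\<^sup>+\<omega>. ennreal (\<bar>W T \<omega>\<bar> ^ k) \<partial>M)"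
      using S0 tail by (intro nn_integral_power_le_of_tail_le) auto
    also have "\<dots> \<le> 2 * ennreal (sqrt T ^ k * real (dfact (k - 1)))"
      by (intro mult_left_mono WT) simp
    also have "\<dots> = ennreal (2 * (sqrt T ^ k * real (dfact (k - 1))))"
      using T by (simp add: ennreal_mult)
    finally show ?thesis .
  qed
  have int: "integrable M (\<lambda>\<omega>. S \<omega> ^ k)" for k
    by (intro integrableI_nonneg order.strict_trans1[OF nn]) (auto simp: S0)
  have "(\<integral>\<omega>. S \<omega> ^ k \<partial>M) \<le> 2 * (sqrt T ^ k * real (dfact (k - 1)))" for k
  proof -
    have "ennreal (\<integral>\<omega>. S \<omega> ^ k \<partial>M) = (\<integral>\<^sup>+\<omega>. ennreal (S \<omega> ^ k) \<partial>M)"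
      by (rule nn_integral_eq_integral[OF int, symmetric]) (auto simp: S0)
    then have "ennreal (\<integral>\<omega>. S \<omega> ^ k \<partial>M) \<le> ennreal (2 * (sqrt T ^ k * real (dfact (k - 1))))"
      using nn[of k] by simp
    then show ?thesis using T by (subst (asm) ennreal_le_iff) auto
  qed
  with Sm S0 bound int that show ?thesis by blast
qed

section \<open>Integrals of continuous paths\<close>

text \<open>Sampling the paths along the grid \<open>\<lfloor>n s\<rfloor> / n\<close> exhibits a process with continuous paths
  as a limit of jointly measurable ones.\<close>
lemma borel_measurable_integral_continuous_paths:
  fixes K :: "real \<Rightarrow> 'a \<Rightarrow> 'b::euclidean_space"
  assumes cont: "\<And>\<omega>. \<omega> \<in> space M \<Longrightarrow> continuous_on {\<alpha>..\<beta>} (\<lambda>s. K s \<omega>)"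
    and meas: "\<And>s. s \<in> {\<alpha>..\<beta>} \<Longrightarrow> K s \<in> borel_measurable M"
  shows "(\<lambda>\<omega>. integral {\<alpha>..\<beta>} (\<lambda>s. K s \<omega>)) \<in> borel_measurable M"
proof (cases "\<alpha> \<le> \<beta>")
  case True
  \<comment> \<open>Rounding down may leave the interval on the left, and the product space contains
    every real s; clamping keeps the sample times where \<open>K\<close> is measurable and
    continuous.\<close>
  define cl where "cl s = max \<alpha> (min \<beta> s)" for s
  have cl: "cl s \<in> {\<alpha>..\<beta>}" for s using True by (auto simp: cl_def)
  have cl_id: "cl s = s" if "s \<in> {\<alpha>..\<beta>}" for s using that by (auto simp: cl_def)
  define H where "H n = (\<lambda>(\<omega>, s). K (cl (real_of_int \<lfloor>real (Suc n) * s\<rfloor> / real (Suc n))) \<omega>)" for n :: nat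
  have Hm: "H n \<in> borel_measurable (M \<Otimes>\<^sub>M lborel)" for n
  proof -
    have "(\<lambda>z. K (cl (real_of_int \<lfloor>real (Suc n) * snd z\<rfloor> / real (Suc n))) (fst z)) \<in> borel_measurable (M \<Otimes>\<^sub>M lborel)"
    \<comment> \<open>The floor takes countably many values, and once it is frozen at i the time no
      longer varies, so measurability of \<open>K\<close> at fixed times is enough.\<close>
    proof (rule measurable_compose_countable[where f="\<lambda>i z. K (cl (real_of_int i / real (Suc n))) (fst z)"])
      fix i :: int
      show "(\<lambda>z. K (cl (real_of_int i / real (Suc n))) (fst z)) \<in> borel_measurable (M \<Otimes>\<^sub>M lborel)"
        by (rule measurable_compose[OF measurable_fst meas[OF cl]])
    qed measurable
    then show ?thesis by (simp add: H_def case_prod_beta')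
  qed
  have grid: "(\<lambda>n. real_of_int \<lfloor>real (Suc n) * s\<rfloor> / real (Suc n)) \<longlonglongrightarrow> s" for s :: real
  proof (rule tendsto_sandwich)
    have "s - 1 / real (Suc n) \<le> real_of_int \<lfloor>real (Suc n) * s\<rfloor> / real (Suc n)" for n
    proof -
      have "s - 1 / real (Suc n) = (real (Suc n) * s - 1) / real (Suc n)"
        by (simp add: diff_divide_distrib del: of_nat_Suc)
      also have "\<dots> \<le> real_of_int \<lfloor>real (Suc n) * s\<rfloor> / real (Suc n)"
        by (intro divide_right_mono) linarith+
      finally show ?thesis .
    qed
    then show "\<forall>\<^sub>F n in sequentially. s - 1 / real (Suc n) \<le> real_of_int \<lfloor>real (Suc n) * s\<rfloor> / real (Suc n)" by simp
    have "real_of_int \<lfloor>real (Suc n) * s\<rfloor> / real (Suc n) \<le> s" for n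
    proof -
      have "real_of_int \<lfloor>real (Suc n) * s\<rfloor> / real (Suc n) \<le> real (Suc n) * s / real (Suc n)"
        by (intro divide_right_mono) linarith+
      then show ?thesis by (simp del: of_nat_Suc)
    qed
    then show "\<forall>\<^sub>F n in sequentially. real_of_int \<lfloor>real (Suc n) * s\<rfloor> / real (Suc n) \<le> s" by simp
    have "(\<lambda>n. 1 / real (Suc n)) \<longlonglongrightarrow> 0" using LIMSEQ_inverse_real_of_nat by (simp add: field_simps)
    then show "(\<lambda>n. s - 1 / real (Suc n)) \<longlonglongrightarrow> s" by (auto intro: tendsto_eq_intros)
  qed simp
  define G where "G = (\<lambda>(\<omega>, s). K (cl s) \<omega>)"
  have "G \<in> borel_measurable (M \<Otimes>\<^sub>M lborel)"
  proof (rule borel_measurable_LIMSEQ_metric[OF Hm])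
    fix z assume "z \<in> space (M \<Otimes>\<^sub>M (lborel :: real measure))"
    then obtain \<omega> s where z: "z = (\<omega>, s)" "\<omega> \<in> space M" by (auto simp: space_pair_measure)
    have "continuous_on UNIV cl" unfolding cl_def by (intro continuous_intros)
    then have "continuous_on UNIV (\<lambda>s. K (cl s) \<omega>)"
      by (rule continuous_on_compose2[OF cont[OF z(2)]]) (use cl in auto)
    then have "isCont (\<lambda>s. K (cl s) \<omega>) s" by (simp add: continuous_on_eq_continuous_at)
    from isCont_tendsto_compose[OF this grid[of s]]
    show "(\<lambda>n. H n z) \<longlonglongrightarrow> G z" by (simp add: H_def G_def z)
  qed
  then have "(\<lambda>z. indicator {\<alpha>..\<beta>} (snd z) *\<^sub>R G z) \<in> borel_measurable (M \<Otimes>\<^sub>M lborel)"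
    by (rule borel_measurable_scaleR[rotated]) measurable
  then have "(\<lambda>\<omega>. \<integral>s. indicator {\<alpha>..\<beta>} s *\<^sub>R G (\<omega>, s) \<partial>lborel) \<in> borel_measurable M"
    by (intro lborel.borel_measurable_lebesgue_integral) (simp add: case_prod_beta')
  also have "?this \<longleftrightarrow> ?thesis"
  proof (rule measurable_cong)
    fix \<omega> assume \<omega>: "\<omega> \<in> space M"
    have "(\<integral>s. indicator {\<alpha>..\<beta>} s *\<^sub>R G (\<omega>, s) \<partial>lborel) = (\<integral>s. indicator {\<alpha>..\<beta>} s *\<^sub>R K s \<omega> \<partial>lborel)"
      by (intro Bochner_Integration.integral_cong) (auto simp: indicator_def G_def cl_id)
    also have "\<dots> = integral {\<alpha>..\<beta>} (\<lambda>s. K s \<omega>)"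
      using set_borel_integral_eq_integral(2)[OF borel_integrable_atLeastAtMost'[OF cont[OF \<omega>]]]
      by (simp add: set_lebesgue_integral_def)
    finally show "(\<integral>s. indicator {\<alpha>..\<beta>} s *\<^sub>R G (\<omega>, s) \<partial>lborel) = integral {\<alpha>..\<beta>} (\<lambda>s. K s \<omega>)" .
  qed
  finally show ?thesis .
qed simp

text \<open>The preimages under f and g differ only inside a null set, all of whose subsets are
  measurable. The solutions \<open>X t x\<close> are known only through their equation, so this is
  how the integrand defining \<open>f\<close> is seen to be measurable.\<close>

lemma borel_measurable_AE_eq_complete:
  assumes null: "\<And>N. N \<subseteq> space M \<Longrightarrow> \<exists>A\<in>null_sets M. N \<subseteq> A \<Longrightarrow> N \<in> sets M"
    and g: "g \<in> borel_measurable M" and eq: "AE \<omega> in M. f \<omega> = g \<omega>"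
  shows "f \<in> borel_measurable M"
proof (rule measurableI)
  fix B :: "'b set" assume B: "B \<in> sets borel"
  obtain N where N: "N \<in> null_sets M" "{\<omega>\<in>space M. f \<omega> \<noteq> g \<omega>} \<subseteq> N"
    using eq by (auto elim!: AE_E3)
  have "f -` B \<inter> space M = (g -` B \<inter> space M - N) \<union> (f -` B \<inter> space M \<inter> N)"
    using N(2) by auto
  moreover have "f -` B \<inter> space M \<inter> N \<in> sets M"
    using N(1) by (intro null) auto
  moreover have "g -` B \<inter> space M \<in> sets M"
    using g B by (rule measurable_sets)
  ultimately show "f -` B \<inter> space M \<in> sets M"
    using N(1) by (metis null_setsD2 sets.Diff sets.Un)
qed simp

section \<open>Domination by negligible power series\<close>

lemma power_add_le_2_power:
  fixes y z :: real
  assumes "0 \<le> y" "0 \<le> z"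
  shows "(y + z) ^ k \<le> 2 ^ k * (y ^ k + z ^ k)"
proof -
  have "(y + z) ^ k \<le> (2 * max y z) ^ k"
    using assms by (intro power_mono) auto
  also have "\<dots> = 2 ^ k * max y z ^ k" by (simp add: power_mult_distrib)
  also have "\<dots> \<le> 2 ^ k * (y ^ k + z ^ k)"
    using assms by (intro mult_left_mono) (auto simp: max_def)
  finally show ?thesis .
qed

lemma ps_abs_eval_sum_le:
  assumes h: "negligible_dfact h" and "0 \<le> y" "0 \<le> z"
  shows "ps_abs_eval h (y + z) \<le> ps_abs_eval (\<lambda>k. h k * 2 ^ k) y + ps_abs_eval (\<lambda>k. h k * 2 ^ k) z"
proof -
  have h2: "negligible_dfact (\<lambda>k. h k * 2 ^ k)" by (rule negligible_dfact_scale[OF h])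
  have "ps_abs_eval h (y + z) \<le> (\<Sum>k. \<bar>h k * 2 ^ k\<bar> * y ^ k + \<bar>h k * 2 ^ k\<bar> * z ^ k)"
    unfolding ps_abs_eval_def
  proof (rule suminf_le)
    fix k
    show "\<bar>h k\<bar> * (y + z) ^ k \<le> \<bar>h k * 2 ^ k\<bar> * y ^ k + \<bar>h k * 2 ^ k\<bar> * z ^ k"
      using mult_left_mono[OF power_add_le_2_power[OF assms(2,3), of k] abs_ge_zero[of "h k"]]
      by (simp add: abs_mult algebra_simps)
  qed (intro summable_ps_abs_eval h h2 summable_add)+
  also have "\<dots> = ps_abs_eval (\<lambda>k. h k * 2 ^ k) y + ps_abs_eval (\<lambda>k. h k * 2 ^ k) z"
    unfolding ps_abs_eval_def by (intro suminf_add[symmetric] summable_ps_abs_eval h2)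
  finally show ?thesis .
qed

text \<open>Here the two growth conditions meet: the expectation of the k-th term is at most
  \<open>C * \<bar>h k\<bar> * R ^ k * (k - 1)!!\<close>, and negligibility of \<open>h\<close>
  makes these numbers summable for every R.\<close>

lemma integrable_ps_abs_eval:
  assumes h: "negligible_dfact h"
    and D0: "\<And>\<omega>. \<omega> \<in> space M \<Longrightarrow> 0 \<le> D \<omega>"
    and int: "\<And>k. integrable M (\<lambda>\<omega>. D \<omega> ^ k)"
    and le: "\<And>k. (\<integral>\<omega>. D \<omega> ^ k \<partial>M) \<le> C * (R ^ k * real (dfact (k - 1)))"
    and R: "0 \<le> R"
  shows "integrable M (\<lambda>\<omega>. ps_abs_eval h (D \<omega>))"
  unfolding ps_abs_eval_def
proof (rule integrable_suminf)
  show "integrable M (\<lambda>\<omega>. \<bar>h k\<bar> * D \<omega> ^ k)" for k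
    using int by simp
  show "AE \<omega> in M. summable (\<lambda>k. norm (\<bar>h k\<bar> * D \<omega> ^ k))"
    using negligible_dfact_summable_norm[OF negligible_dfact_abs[OF h]] by simp
  have eq: "(\<integral>\<omega>. norm (\<bar>h k\<bar> * D \<omega> ^ k) \<partial>M) = \<bar>h k\<bar> * (\<integral>\<omega>. D \<omega> ^ k \<partial>M)" for k
  proof -
    have "(\<integral>\<omega>. norm (\<bar>h k\<bar> * D \<omega> ^ k) \<partial>M) = (\<integral>\<omega>. \<bar>h k\<bar> * D \<omega> ^ k \<partial>M)"
      using D0 by (intro Bochner_Integration.integral_cong) (auto simp: abs_mult)
    then show ?thesis by simp
  qed
  have nonneg: "0 \<le> (\<integral>\<omega>. D \<omega> ^ k \<partial>M)" for k
    using D0 by (intro integral_nonneg_AE AE_I2) auto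
  show "summable (\<lambda>k. \<integral>\<omega>. norm (\<bar>h k\<bar> * D \<omega> ^ k) \<partial>M)"
    unfolding eq
  proof (rule summable_comparison_test'[OF summable_mult[OF negligible_dfact_summable_abs[OF h, of R], of C], of 0])
    fix k
    have "\<bar>h k\<bar> * (\<integral>\<omega>. D \<omega> ^ k \<partial>M) \<le> \<bar>h k\<bar> * (C * (R ^ k * real (dfact (k - 1))))"
      by (intro mult_left_mono le) auto
    then show "norm (\<bar>h k\<bar> * (\<integral>\<omega>. D \<omega> ^ k \<partial>M)) \<le> C * (\<bar>h k\<bar> * real (dfact (k - 1)) * \<bar>R\<bar> ^ k)"
      using nonneg[of k] R by (simp add: abs_mult algebra_simps)
  qed
qed

section \<open>Differentiation under the expectation\<close>

lemma has_vector_derivative_iff_quotient: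
  fixes f :: "real \<Rightarrow> 'b::real_normed_vector"
  shows "(f has_vector_derivative f') (at x) \<longleftrightarrow> ((\<lambda>y. (f y - f x) /\<^sub>R (y - x)) \<longlongrightarrow> f') (at x)"
proof -
  have "(f has_vector_derivative f') (at x) \<longleftrightarrow>
      ((\<lambda>y. norm ((f y - f x) - (y - x) *\<^sub>R f') / norm (y - x)) \<longlongrightarrow> 0) (at x)"
    unfolding has_vector_derivative_def has_derivative_iff_norm
    by (simp add: bounded_linear_scaleR_left)
  also have "\<dots> \<longleftrightarrow> ((\<lambda>y. norm ((f y - f x) /\<^sub>R (y - x) - f')) \<longlongrightarrow> 0) (at x)"
  proof (rule Lim_cong_within)
    fix y assume "y \<noteq> x"
    then have "(f y - f x) /\<^sub>R (y - x) - f' = ((f y - f x) - (y - x) *\<^sub>R f') /\<^sub>R (y - x)"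
      by (simp add: scaleR_diff_right)
    then show "norm ((f y - f x) - (y - x) *\<^sub>R f') / norm (y - x) = norm ((f y - f x) /\<^sub>R (y - x) - f')"
      by (simp add: divide_inverse mult.commute)
  qed auto
  also have "\<dots> \<longleftrightarrow> ((\<lambda>y. (f y - f x) /\<^sub>R (y - x)) \<longlongrightarrow> f') (at x)"
    by (simp add: tendsto_norm_zero_iff LIM_zero_iff)
  finally show ?thesis .
qed

lemma has_vector_derivative_norm_bound:
  fixes f :: "real \<Rightarrow> 'b::real_normed_vector"
  assumes "convex S" "\<And>y. y \<in> S \<Longrightarrow> (f has_vector_derivative f' y) (at y within S)"
    and "\<And>y. y \<in> S \<Longrightarrow> norm (f' y) \<le> B" "x \<in> S" "y \<in> S"
  shows "norm (f x - f y) \<le> B * norm (x - y)"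
proof (rule differentiable_bound[OF assms(1)])
  fix z assume z: "z \<in> S"
  show "(f has_derivative (\<lambda>h. h *\<^sub>R f' z)) (at z within S)"
    using assms(2)[OF z] by (simp add: has_vector_derivative_def)
  show "onorm (\<lambda>h. h *\<^sub>R f' z) \<le> B"
    using assms(3)[OF z] onorm_scaleR_left[of "\<lambda>h. h" "f' z"] by (simp add: bounded_linear_ident onorm_id)
qed fact+

text \<open>A bound on the derivative over the unit ball around x bounds the difference quotients
  there by the mean value inequality, so dominated convergence applies along every sequence tending
  to x.\<close>

lemma has_vector_derivative_integral_dominated:
  fixes G :: "real \<Rightarrow> 'a \<Rightarrow> 'b::{banach, second_countable_topology}"
  assumes deriv: "\<And>y \<omega>. \<omega> \<in> space M \<Longrightarrow> ((\<lambda>y. G y \<omega>) has_vector_derivative G' y \<omega>) (at y)"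
    and int: "\<And>y. integrable M (G y)" and meas: "G' x \<in> borel_measurable M"
    and w: "integrable M w" and le: "\<And>y \<omega>. \<bar>y - x\<bar> \<le> 1 \<Longrightarrow> \<omega> \<in> space M \<Longrightarrow> norm (G' y \<omega>) \<le> w \<omega>"
  shows "((\<lambda>y. \<integral>\<omega>. G y \<omega> \<partial>M) has_vector_derivative (\<integral>\<omega>. G' x \<omega> \<partial>M)) (at x)"
  unfolding has_vector_derivative_iff_quotient
proof (subst tendsto_at_iff_sequentially, intro allI impI)
  fix X :: "nat \<Rightarrow> real" assume X: "\<forall>i. X i \<in> UNIV - {x}" "X \<longlonglongrightarrow> x"
  \<comment> \<open>The majorant is valid only within distance 1 of x, so the first N terms are
    dropped.\<close>
  from X(2) obtain N where N: "\<And>n. n \<ge> N \<Longrightarrow> \<bar>X n - x\<bar> < 1"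
    using LIMSEQ_D[of X x 1] by auto
  have "(\<lambda>n. \<integral>\<omega>. (G (X (n + N)) \<omega> - G x \<omega>) /\<^sub>R (X (n + N) - x) \<partial>M) \<longlonglongrightarrow> (\<integral>\<omega>. G' x \<omega> \<partial>M)"
  proof (rule integral_dominated_convergence[OF meas _ w])
    show "(\<lambda>\<omega>. (G (X (n + N)) \<omega> - G x \<omega>) /\<^sub>R (X (n + N) - x)) \<in> borel_measurable M" for n
      using int by (intro borel_measurable_scaleR borel_measurable_diff borel_measurable_integrable) auto
    show "AE \<omega> in M. (\<lambda>n. (G (X (n + N)) \<omega> - G x \<omega>) /\<^sub>R (X (n + N) - x)) \<longlonglongrightarrow> G' x \<omega>"
    proof (rule AE_I2)
      fix \<omega> assume "\<omega> \<in> space M"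
      then have "((\<lambda>y. (G y \<omega> - G x \<omega>) /\<^sub>R (y - x)) \<longlongrightarrow> G' x \<omega>) (at x)"
        by (intro has_vector_derivative_iff_quotient[THEN iffD1] deriv)
      then have "(\<lambda>n. (G (X n) \<omega> - G x \<omega>) /\<^sub>R (X n - x)) \<longlonglongrightarrow> G' x \<omega>"
        using X unfolding tendsto_at_iff_sequentially by (simp add: comp_def)
      then show "(\<lambda>n. (G (X (n + N)) \<omega> - G x \<omega>) /\<^sub>R (X (n + N) - x)) \<longlonglongrightarrow> G' x \<omega>"
        by (rule LIMSEQ_ignore_initial_segment)
    qed
    show "AE \<omega> in M. norm ((G (X (n + N)) \<omega> - G x \<omega>) /\<^sub>R (X (n + N) - x)) \<le> w \<omega>" for n
    proof (rule AE_I2)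
      fix \<omega> assume \<omega>: "\<omega> \<in> space M"
      have ne: "X (n + N) - x \<noteq> 0" using X by simp
      have "norm (G (X (n + N)) \<omega> - G x \<omega>) \<le> w \<omega> * norm (X (n + N) - x)"
      proof (rule has_vector_derivative_norm_bound[where S="cball x 1" and f'="\<lambda>y. G' y \<omega>"])
        show "norm (G' y \<omega>) \<le> w \<omega>" if "y \<in> cball x 1" for y
          using that \<omega> by (intro le) (auto simp: dist_real_def)
        show "X (n + N) \<in> cball x 1" using N[of "n + N"] by (auto simp: dist_real_def)
      qed (use deriv \<omega> in \<open>auto intro: has_vector_derivative_at_within\<close>)
      then have "norm (G (X (n + N)) \<omega> - G x \<omega>) / \<bar>X (n + N) - x\<bar> \<le> w \<omega>"
        using ne by (simp add: pos_divide_le_eq)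
      then show "norm ((G (X (n + N)) \<omega> - G x \<omega>) /\<^sub>R (X (n + N) - x)) \<le> w \<omega>"
        by (simp add: divide_inverse mult.commute)
    qed
  qed
  then have "(\<lambda>n. \<integral>\<omega>. (G (X n) \<omega> - G x \<omega>) /\<^sub>R (X n - x) \<partial>M) \<longlonglongrightarrow> (\<integral>\<omega>. G' x \<omega> \<partial>M)"
    by (rule LIMSEQ_offset)
  also have "(\<lambda>n. \<integral>\<omega>. (G (X n) \<omega> - G x \<omega>) /\<^sub>R (X n - x) \<partial>M)
      = (\<lambda>y. ((\<integral>\<omega>. G y \<omega> \<partial>M) - (\<integral>\<omega>. G x \<omega> \<partial>M)) /\<^sub>R (y - x)) \<circ> X"
    using int by (simp add: fun_eq_iff)
  finally show "((\<lambda>y. ((\<integral>\<omega>. G y \<omega> \<partial>M) - (\<integral>\<omega>. G x \<omega> \<partial>M)) /\<^sub>R (y - x)) \<circ> X) \<longlonglongrightarrow> (\<integral>\<omega>. G' x \<omega> \<partial>M)" .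
qed

section \<open>The exponent and its derivatives\<close>

text \<open>\<open>U\<close> plays the role of the solution started at time 0 in 0, modified on a null set, and
  \<open>flow t x s\<close> is then the solution started at time \<open>t\<close> in \<open>x\<close>; the random variable \<open>D\<close> dominates
  the paths.\<close>
locale gaussian_functional = prob_space M for M :: "'a measure" +
  fixes U :: "real \<Rightarrow> 'a \<Rightarrow> real" and D :: "'a \<Rightarrow> real" and b T :: real
    and u1 u2 u3 :: "real \<Rightarrow> complex" and w :: complex and p1 p2 p3 q :: "nat \<Rightarrow> real"
  assumes T_pos: "0 < T"
    and U_cont: "\<And>\<omega>. \<omega> \<in> space M \<Longrightarrow> continuous_on {0..T} (\<lambda>s. U s \<omega>)"
    and U_meas: "\<And>s. s \<in> {0..T} \<Longrightarrow> U s \<in> borel_measurable M"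
    and U_le: "\<And>s \<omega>. s \<in> {0..T} \<Longrightarrow> \<omega> \<in> space M \<Longrightarrow> \<bar>U s \<omega>\<bar> \<le> D \<omega>"
    and D_meas: "D \<in> borel_measurable M"
    and D_int: "\<And>h. negligible_dfact h \<Longrightarrow> integrable M (\<lambda>\<omega>. ps_abs_eval h (D \<omega>))"
    and u_cont: "continuous_on {0..T} u1" "continuous_on {0..T} u2" "continuous_on {0..T} u3"
    and negl: "negligible_dfact p1" "negligible_dfact p2" "negligible_dfact p3" "negligible_dfact q"
    and Re_rate: "\<And>s y. s \<in> {0..T} \<Longrightarrow> Re (u1 s * complex_of_real (ps_eval p1 y)
        + u2 s * complex_of_real (ps_eval p2 y) + u3 s * complex_of_real (ps_eval p3 y)) \<le> 0"
    and Re_terminal: "\<And>y. Re (w * complex_of_real (ps_eval q y)) \<le> 0"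
begin

lemma D_nonneg: "\<omega> \<in> space M \<Longrightarrow> 0 \<le> D \<omega>"
  using U_le[of 0 \<omega>] T_pos by auto

definition flow :: "real \<Rightarrow> real \<Rightarrow> real \<Rightarrow> 'a \<Rightarrow> real" where
  "flow t x s \<omega> = U s \<omega> + exp (b * (s - t)) * (x - U t \<omega>)"

text \<open>The n-th derivative in x of \<open>u s\<close> times the series \<open>p\<close> at the
  flow. The flow is affine in x with slope \<open>exp (b * (s - t))\<close>, so each differentiation
  contributes one such factor and one \<open>diffs\<close>, and no further terms arise.\<close>

definition summand :: "(real \<Rightarrow> complex) \<Rightarrow> (nat \<Rightarrow> real) \<Rightarrow> nat \<Rightarrow> real \<Rightarrow> real \<Rightarrow> real \<Rightarrow> 'a \<Rightarrow> complex" where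
  "summand u p n t x s \<omega> =
     u s * complex_of_real (exp (b * (s - t)) ^ n * ps_eval ((diffs ^^ n) p) (flow t x s \<omega>))"

lemma negligible_funpow_diffs: "negligible_dfact p \<Longrightarrow> negligible_dfact ((diffs ^^ n) p)"
  by (induction n) (auto intro: negligible_dfact_diffs)

text \<open>Both times and the starting point are arbitrary continuous functions on a set. One
  statement then covers continuity in the rescaled time, in (t, x), and in all variables
  jointly.\<close>

lemma flow_continuous:
  assumes "\<omega> \<in> space M" "continuous_on A t" "continuous_on A x" "continuous_on A s"
    and "\<And>z. z \<in> A \<Longrightarrow> t z \<in> {0..T}" "\<And>z. z \<in> A \<Longrightarrow> s z \<in> {0..T}"
  shows "continuous_on A (\<lambda>z. flow (t z) (x z) (s z) \<omega>)"
proof -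
  have "continuous_on A (\<lambda>z. U (t z) \<omega>)" "continuous_on A (\<lambda>z. U (s z) \<omega>)"
    using assms by (auto intro!: continuous_on_compose2[OF U_cont[OF assms(1)]])
  then show ?thesis unfolding flow_def by (intro continuous_intros assms)
qed

lemma summand_continuous:
  assumes p: "negligible_dfact p" and u: "continuous_on {0..T} u"
    and "\<omega> \<in> space M" "continuous_on A t" "continuous_on A x" "continuous_on A s"
    and "\<And>z. z \<in> A \<Longrightarrow> t z \<in> {0..T}" "\<And>z. z \<in> A \<Longrightarrow> s z \<in> {0..T}"
  shows "continuous_on A (\<lambda>z. summand u p n (t z) (x z) (s z) \<omega>)"
proof -
  have "continuous_on A (\<lambda>z. ps_eval ((diffs ^^ n) p) (flow (t z) (x z) (s z) \<omega>))"
    by (rule continuous_on_compose2[OF continuous_on_ps_eval[OF negligible_funpow_diffs[OF p], of UNIV]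
          flow_continuous[OF assms(3-8)]]) auto
  moreover have "continuous_on A (\<lambda>z. u (s z))"
    using assms(6,8) by (auto intro!: continuous_on_compose2[OF u])
  ultimately show ?thesis unfolding summand_def by (intro continuous_intros assms)
qed

lemma summand_derivative:
  assumes p: "negligible_dfact p"
  shows "((\<lambda>x. summand u p n t x s \<omega>) has_vector_derivative summand u p (Suc n) t x s \<omega>) (at x)"
proof -
  have "((\<lambda>x. ps_eval ((diffs ^^ n) p) (flow t x s \<omega>)) has_field_derivative
      ps_eval (diffs ((diffs ^^ n) p)) (flow t x s \<omega>) * exp (b * (s - t))) (at x)"
    by (rule DERIV_chain2[OF has_field_derivative_ps_eval[OF negligible_funpow_diffs[OF p]]])
      (auto simp: flow_def intro!: derivative_eq_intros)
  from DERIV_cmult[OF this, of "exp (b * (s - t)) ^ n"]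
  have "((\<lambda>x. exp (b * (s - t)) ^ n * ps_eval ((diffs ^^ n) p) (flow t x s \<omega>)) has_field_derivative
      exp (b * (s - t)) ^ Suc n * ps_eval ((diffs ^^ Suc n) p) (flow t x s \<omega>)) (at x)"
    by (simp add: mult_ac)
  from has_vector_derivative_mult_right[OF has_vector_derivative_of_real[OF this], of "u s"]
  show ?thesis unfolding summand_def .
qed

lemma summand_measurable:
  assumes p: "negligible_dfact p" and "t \<in> {0..T}" "s \<in> {0..T}"
  shows "summand u p n t x s \<in> borel_measurable M"
proof -
  have [measurable]: "U t \<in> borel_measurable M" "U s \<in> borel_measurable M"
    using U_meas assms by auto
  have [measurable]: "ps_eval ((diffs ^^ n) p) \<in> borel_measurable borel"
    by (intro borel_measurable_continuous_onI continuous_on_ps_eval negligible_funpow_diffs p)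
  show ?thesis unfolding summand_def flow_def by measurable
qed

lemma exp_flow_le: "t \<in> {0..T} \<Longrightarrow> s \<in> {0..T} \<Longrightarrow> exp (b * (s - t)) \<le> exp (\<bar>b\<bar> * T)"
proof -
  assume "t \<in> {0..T}" "s \<in> {0..T}"
  then have "\<bar>b\<bar> * \<bar>s - t\<bar> \<le> \<bar>b\<bar> * T" by (intro mult_left_mono) auto
  then have "b * (s - t) \<le> \<bar>b\<bar> * T" using abs_ge_self[of "b * (s - t)"] by (simp add: abs_mult)
  then show ?thesis by simp
qed

lemma flow_le:
  assumes "t \<in> {0..T}" "s \<in> {0..T}" "\<omega> \<in> space M"
  shows "\<bar>flow t x s \<omega>\<bar> \<le> (1 + exp (\<bar>b\<bar> * T)) * (\<bar>x\<bar> + D \<omega>)"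
proof -
  have "\<bar>exp (b * (s - t)) * (x - U t \<omega>)\<bar> \<le> exp (\<bar>b\<bar> * T) * (\<bar>x\<bar> + D \<omega>)"
    unfolding abs_mult using exp_flow_le[OF assms(1,2)] U_le[OF assms(1,3)]
    by (intro mult_mono) auto
  moreover have "\<bar>U s \<omega>\<bar> \<le> \<bar>x\<bar> + D \<omega>" using U_le[OF assms(2,3)] by simp
  ultimately show ?thesis
    using abs_triangle_ineq[of "U s \<omega>" "exp (b * (s - t)) * (x - U t \<omega>)"]
    unfolding flow_def by (simp only: distrib_right mult_1_left)
qed

lemma summand_bound:
  assumes p: "negligible_dfact p" and u: "continuous_on {0..T} u"
  obtains h where "negligible_dfact h"
    "\<And>t s x \<omega>. t \<in> {0..T} \<Longrightarrow> s \<in> {0..T} \<Longrightarrow> \<omega> \<in> space M \<Longrightarrow>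
       norm (summand u p n t x s \<omega>) \<le> ps_abs_eval h (\<bar>x\<bar> + D \<omega>)"
proof -
  define A where "A = 1 + exp (\<bar>b\<bar> * T)"
  define r where "r = (diffs ^^ n) p"
  have r: "negligible_dfact r" unfolding r_def by (rule negligible_funpow_diffs[OF p])
  have A: "0 \<le> A" by (simp add: A_def add_nonneg_nonneg)
  obtain B where B: "\<And>s. s \<in> {0..T} \<Longrightarrow> norm (u s) \<le> B"
    using compact_imp_bounded[OF compact_continuous_image[OF u compact_Icc]]
    unfolding bounded_iff by (auto simp del: atLeastAtMost_iff)
  have B0: "0 \<le> B" using B[of 0] T_pos norm_ge_zero[of "u 0"] by (simp del: norm_ge_zero)
  \<comment> \<open>\<open>B\<close> bounds \<open>u\<close>, the exponential bounds the n chain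
    rule factors, and \<open>A\<close> is the constant of \<open>flow_le\<close>, moved from the
    argument into the coefficients.\<close>
  define h where "h k = (B * exp (\<bar>b\<bar> * T) ^ n) * (r k * A ^ k)" for k
  have rA: "negligible_dfact (\<lambda>k. r k * A ^ k)" by (rule negligible_dfact_scale[OF r])
  have h: "negligible_dfact h" unfolding h_def by (rule negligible_dfact_cmult[OF rA])
  have "norm (summand u p n t x s \<omega>) \<le> ps_abs_eval h (\<bar>x\<bar> + D \<omega>)"
    if ts: "t \<in> {0..T}" "s \<in> {0..T}" "\<omega> \<in> space M" for t s x \<omega>
  proof -
    have "\<bar>ps_eval r (flow t x s \<omega>)\<bar> \<le> ps_abs_eval r \<bar>flow t x s \<omega>\<bar>"
      by (rule abs_ps_eval_le[OF r])
    also have "\<dots> \<le> ps_abs_eval r (A * (\<bar>x\<bar> + D \<omega>))"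
      using flow_le[OF ts] by (intro ps_abs_eval_mono[OF r]) (auto simp: A_def)
    finally have *: "\<bar>ps_eval r (flow t x s \<omega>)\<bar> \<le> ps_abs_eval (\<lambda>k. r k * A ^ k) (\<bar>x\<bar> + D \<omega>)"
      by (simp add: ps_abs_eval_scale A)
    have "norm (summand u p n t x s \<omega>)
        = norm (u s) * (exp (b * (s - t)) ^ n * \<bar>ps_eval r (flow t x s \<omega>)\<bar>)"
      unfolding summand_def r_def[symmetric] norm_mult norm_of_real by (simp add: abs_mult)
    also have "\<dots> \<le> B * (exp (\<bar>b\<bar> * T) ^ n * ps_abs_eval (\<lambda>k. r k * A ^ k) (\<bar>x\<bar> + D \<omega>))"
      using B[OF ts(2)] B0 exp_flow_le[OF ts(1,2)] *
      by (intro mult_mono power_mono) auto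
    also have "\<dots> = ps_abs_eval h (\<bar>x\<bar> + D \<omega>)"
      unfolding h_def using B0 by (subst ps_abs_eval_cmult[OF rA]) (simp add: abs_mult)
    finally show ?thesis .
  qed
  with h that show ?thesis by blast
qed

text \<open>The time integral over \<open>{t..T}\<close> is rescaled to the unit interval, so that continuity in \<open>t\<close> is
  a statement about integrals with a parameter.\<close>
definition integrand :: "nat \<Rightarrow> real \<Rightarrow> real \<Rightarrow> real \<Rightarrow> 'a \<Rightarrow> complex" where
  "integrand n t x \<theta> \<omega> =
     complex_of_real (T - t) *
       (summand u1 p1 n t x (t + \<theta> * (T - t)) \<omega> + summand u2 p2 n t x (t + \<theta> * (T - t)) \<omega>
        + summand u3 p3 n t x (t + \<theta> * (T - t)) \<omega>)
     + summand (\<lambda>_. w) q n t x T \<omega>"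

text \<open>The terminal term is constant in \<open>\<theta>\<close> and passes unchanged through an
  integral over an interval of length 1. Putting it inside lets a single parameter integral carry
  the whole exponent.\<close>

definition exponent :: "nat \<Rightarrow> real \<Rightarrow> real \<Rightarrow> 'a \<Rightarrow> complex" where
  "exponent n t x \<omega> = integral {0..1} (\<lambda>\<theta>. integrand n t x \<theta> \<omega>)"

lemma rescaled_time:
  assumes "t \<in> {0..T}" "\<theta> \<in> {0..1}"
  shows "t + \<theta> * (T - t) \<in> {0..T}"
proof -
  have "\<theta> * (T - t) \<le> 1 * (T - t)"
    using assms by (intro mult_right_mono) auto
  moreover have "0 \<le> \<theta> * (T - t)"
    using assms by (intro mult_nonneg_nonneg) auto
  ultimately show ?thesis using assms by auto
qed

lemma integrand_continuous:
  assumes \<omega>: "\<omega> \<in> space M" and c: "continuous_on A t" "continuous_on A x" "continuous_on A \<theta>"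
    and t: "\<And>z. z \<in> A \<Longrightarrow> t z \<in> {0..T}" and th: "\<And>z. z \<in> A \<Longrightarrow> \<theta> z \<in> {0..1}"
  shows "continuous_on A (\<lambda>z. integrand n (t z) (x z) (\<theta> z) \<omega>)"
proof -
  have s: "continuous_on A (\<lambda>z. t z + \<theta> z * (T - t z))" "continuous_on A (\<lambda>z. T)"
    by (intro continuous_intros c)+
  have sT: "t z + \<theta> z * (T - t z) \<in> {0..T}" if "z \<in> A" for z
    by (rule rescaled_time[OF t[OF that] th[OF that]])
  have TT: "T \<in> {0..T}" using T_pos by simp
  note 1 = summand_continuous[OF negl(1) u_cont(1) \<omega> c(1,2) s(1) t sT, of n]
  note 2 = summand_continuous[OF negl(2) u_cont(2) \<omega> c(1,2) s(1) t sT, of n]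
  note 3 = summand_continuous[OF negl(3) u_cont(3) \<omega> c(1,2) s(1) t sT, of n]
  note 4 = summand_continuous[OF negl(4) continuous_on_const \<omega> c(1,2) s(2) t TT, of w n]
  show ?thesis unfolding integrand_def by (intro continuous_intros 1 2 3 4 c) auto
qed

lemma exponent_continuous:
  assumes \<omega>: "\<omega> \<in> space M"
  shows "continuous_on ({0..T} \<times> UNIV) (\<lambda>z. exponent n (fst z) (snd z) \<omega>)"
  unfolding exponent_def
proof -
  have "continuous_on (({0..T} \<times> UNIV) \<times> cbox 0 1)
      (\<lambda>z. integrand n (fst (fst z)) (snd (fst z)) (snd z) \<omega>)"
    by (rule integrand_continuous[OF \<omega>]) (auto intro!: continuous_intros)
  then show "continuous_on ({0..T} \<times> UNIV)
      (\<lambda>z. integral {0..1} (\<lambda>\<theta>. integrand n (fst z) (snd z) \<theta> \<omega>))"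
    using integral_continuous_on_param[of "{0..T} \<times> UNIV" 0 1 "\<lambda>z \<theta>. integrand n (fst z) (snd z) \<theta> \<omega>"]
    by (simp add: case_prod_beta')
qed

lemma exponent_derivative:
  assumes \<omega>: "\<omega> \<in> space M" and t: "t \<in> {0..T}"
  shows "((\<lambda>x. exponent n t x \<omega>) has_vector_derivative exponent (Suc n) t x \<omega>) (at x)"
proof -
  have "((\<lambda>x. integral (cbox 0 1) (\<lambda>\<theta>. integrand n t x \<theta> \<omega>)) has_vector_derivative
      integral (cbox 0 1) (\<lambda>\<theta>. integrand (Suc n) t x \<theta> \<omega>)) (at x within UNIV)"
  proof (rule leibniz_rule_vector_derivative)
    show "((\<lambda>x. integrand n t x \<theta> \<omega>) has_vector_derivative integrand (Suc n) t x \<theta> \<omega>) (at x within UNIV)" for x \<theta>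
      unfolding integrand_def
      by (intro has_vector_derivative_add has_vector_derivative_mult_right summand_derivative negl)
    show "(\<lambda>\<theta>. integrand n t x \<theta> \<omega>) integrable_on cbox 0 1" for x
      by (intro integrable_continuous integrand_continuous[OF \<omega>]) (use t in \<open>auto intro!: continuous_intros\<close>)
    have "continuous_on (UNIV \<times> cbox 0 1) (\<lambda>z. integrand (Suc n) t (fst z) (snd z) \<omega>)"
      by (rule integrand_continuous[OF \<omega>]) (use t in \<open>auto intro!: continuous_intros\<close>)
    then show "continuous_on (UNIV \<times> cbox 0 1) (\<lambda>(x, \<theta>). integrand (Suc n) t x \<theta> \<omega>)"
      by (simp add: case_prod_beta')
  qed auto
  then show ?thesis by (simp add: exponent_def)
qed

lemma exponent_measurable:
  assumes t: "t \<in> {0..T}"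
  shows "exponent n t x \<in> borel_measurable M"
proof -
  have TT: "T \<in> {0..T}" using T_pos by simp
  have "(\<lambda>\<omega>. integral {0..1} (\<lambda>\<theta>. integrand n t x \<theta> \<omega>)) \<in> borel_measurable M"
  proof (rule borel_measurable_integral_continuous_paths)
    show "continuous_on {0..1} (\<lambda>\<theta>. integrand n t x \<theta> \<omega>)" if "\<omega> \<in> space M" for \<omega>
      by (rule integrand_continuous[OF that]) (use t in \<open>auto intro!: continuous_intros\<close>)
    show "integrand n t x \<theta> \<in> borel_measurable M" if "\<theta> \<in> {0..1}" for \<theta>
      unfolding integrand_def
      by (intro borel_measurable_add borel_measurable_times borel_measurable_const
          summand_measurable negl t rescaled_time[OF t that] TT)
  qed
  then show ?thesis by (simp add: exponent_def[abs_def])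
qed

lemma exponent_bound:
  obtains h where "negligible_dfact h"
    "\<And>t x \<omega>. t \<in> {0..T} \<Longrightarrow> \<omega> \<in> space M \<Longrightarrow> norm (exponent n t x \<omega>) \<le> ps_abs_eval h (\<bar>x\<bar> + D \<omega>)"
proof -
  have TT: "T \<in> {0..T}" using T_pos by simp
  obtain h1 where h1: "negligible_dfact h1" "\<And>t s x \<omega>. t \<in> {0..T} \<Longrightarrow> s \<in> {0..T} \<Longrightarrow> \<omega> \<in> space M \<Longrightarrow>
       norm (summand u1 p1 n t x s \<omega>) \<le> ps_abs_eval h1 (\<bar>x\<bar> + D \<omega>)"
    using summand_bound[OF negl(1) u_cont(1), of n] by blast
  obtain h2 where h2: "negligible_dfact h2" "\<And>t s x \<omega>. t \<in> {0..T} \<Longrightarrow> s \<in> {0..T} \<Longrightarrow> \<omega> \<in> space M \<Longrightarrow>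
       norm (summand u2 p2 n t x s \<omega>) \<le> ps_abs_eval h2 (\<bar>x\<bar> + D \<omega>)"
    using summand_bound[OF negl(2) u_cont(2), of n] by blast
  obtain h3 where h3: "negligible_dfact h3" "\<And>t s x \<omega>. t \<in> {0..T} \<Longrightarrow> s \<in> {0..T} \<Longrightarrow> \<omega> \<in> space M \<Longrightarrow>
       norm (summand u3 p3 n t x s \<omega>) \<le> ps_abs_eval h3 (\<bar>x\<bar> + D \<omega>)"
    using summand_bound[OF negl(3) u_cont(3), of n] by blast
  obtain h4 where h4: "negligible_dfact h4" "\<And>t s x \<omega>. t \<in> {0..T} \<Longrightarrow> s \<in> {0..T} \<Longrightarrow> \<omega> \<in> space M \<Longrightarrow>
       norm (summand (\<lambda>_. w) q n t x s \<omega>) \<le> ps_abs_eval h4 (\<bar>x\<bar> + D \<omega>)"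
    using summand_bound[OF negl(4) continuous_on_const, of w n] by blast
  \<comment> \<open>Adding moduli excludes cancellation, so \<open>ps_abs_eval\<close> is additive
    at each stage; the factor \<open>T\<close> introduced later bounds the Jacobian
    \<open>T - t\<close>.\<close>
  define h12 where "h12 k = \<bar>h1 k\<bar> + \<bar>h2 k\<bar>" for k
  define h123 where "h123 k = \<bar>h12 k\<bar> + \<bar>h3 k\<bar>" for k
  define h where "h k = \<bar>T * h123 k\<bar> + \<bar>h4 k\<bar>" for k
  have n12: "negligible_dfact h12"
    unfolding h12_def by (intro negligible_dfact_add negligible_dfact_abs h1 h2)
  have n123: "negligible_dfact h123"
    unfolding h123_def by (intro negligible_dfact_add negligible_dfact_abs n12 h3)
  have nT: "negligible_dfact (\<lambda>k. T * h123 k)" by (rule negligible_dfact_cmult[OF n123])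
  have h: "negligible_dfact h"
    unfolding h_def by (intro negligible_dfact_add negligible_dfact_abs nT h4)
  have h_eq: "ps_abs_eval h y
      = T * (ps_abs_eval h1 y + ps_abs_eval h2 y + ps_abs_eval h3 y) + ps_abs_eval h4 y" for y
    unfolding h_def ps_abs_eval_add[OF nT h4(1)] ps_abs_eval_cmult[OF n123]
    unfolding h123_def ps_abs_eval_add[OF n12 h3(1)]
    unfolding h12_def ps_abs_eval_add[OF h1(1) h2(1)]
    using T_pos by simp
  have "norm (exponent n t x \<omega>) \<le> ps_abs_eval h (\<bar>x\<bar> + D \<omega>)"
    if t: "t \<in> {0..T}" and \<omega>: "\<omega> \<in> space M" for t x \<omega>
  proof -
    have "norm (integral {0..1} (\<lambda>\<theta>. integrand n t x \<theta> \<omega>)) \<le> ps_abs_eval h (\<bar>x\<bar> + D \<omega>) * (1 - 0)"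
    proof (rule integral_bound)
      show "continuous_on {0..1} (\<lambda>\<theta>. integrand n t x \<theta> \<omega>)"
        by (rule integrand_continuous[OF \<omega>]) (use t in \<open>auto intro!: continuous_intros\<close>)
      show "norm (integrand n t x \<theta> \<omega>) \<le> ps_abs_eval h (\<bar>x\<bar> + D \<omega>)" if "\<theta> \<in> {0..1}" for \<theta>
      proof -
        from that have s: "t + \<theta> * (T - t) \<in> {0..T}" using t by (intro rescaled_time)
        have "norm (complex_of_real (T - t) *
            (summand u1 p1 n t x (t + \<theta> * (T - t)) \<omega> + summand u2 p2 n t x (t + \<theta> * (T - t)) \<omega>
              + summand u3 p3 n t x (t + \<theta> * (T - t)) \<omega>))
          \<le> T * (ps_abs_eval h1 (\<bar>x\<bar> + D \<omega>) + ps_abs_eval h2 (\<bar>x\<bar> + D \<omega>) + ps_abs_eval h3 (\<bar>x\<bar> + D \<omega>))"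
          unfolding norm_mult
          using h1(2)[OF t s \<omega>] h2(2)[OF t s \<omega>] h3(2)[OF t s \<omega>] t T_pos
          by (intro mult_mono norm_triangle_le add_mono) (auto simp del: of_real_diff)
        from norm_triangle_le[OF add_mono[OF this h4(2)[OF t TT \<omega>]]]
        show ?thesis
          unfolding integrand_def h_eq .
      qed
    qed simp
    then show ?thesis by (simp add: exponent_def)
  qed
  with h that show ?thesis by blast
qed

text \<open>The sign assumptions \<open>Re_rate\<close> and \<open>Re_terminal\<close> enter here.
  They bound the exponential by 1 in modulus, so that every derivative is controlled by its
  polynomial factor alone.\<close>

lemma Re_exponent_le:
  assumes t: "t \<in> {0..T}" and \<omega>: "\<omega> \<in> space M"
  shows "Re (exponent 0 t x \<omega>) \<le> 0"
proof -
  have int: "(\<lambda>\<theta>. integrand 0 t x \<theta> \<omega>) integrable_on {0..1}"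
    by (intro integrable_continuous_interval integrand_continuous[OF \<omega>])
      (use t in \<open>auto intro!: continuous_intros\<close>)
  have "Re (integrand 0 t x \<theta> \<omega>) \<le> 0" if "\<theta> \<in> {0..1}" for \<theta>
  proof -
    have "0 \<le> T - t" using t by simp
    moreover have "Re (summand u1 p1 0 t x (t + \<theta> * (T - t)) \<omega> + summand u2 p2 0 t x (t + \<theta> * (T - t)) \<omega>
        + summand u3 p3 0 t x (t + \<theta> * (T - t)) \<omega>) \<le> 0"
      using Re_rate[OF rescaled_time[OF t that]] by (simp add: summand_def)
    ultimately have "(T - t) * Re (summand u1 p1 0 t x (t + \<theta> * (T - t)) \<omega> + summand u2 p2 0 t x (t + \<theta> * (T - t)) \<omega>
        + summand u3 p3 0 t x (t + \<theta> * (T - t)) \<omega>) \<le> 0"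
      by (rule mult_nonneg_nonpos)
    moreover have "Re (summand (\<lambda>_. w) q 0 t x T \<omega>) \<le> 0"
      using Re_terminal by (simp add: summand_def)
    moreover have "Re (complex_of_real r * z) = r * Re z" for r z by simp
    ultimately show ?thesis unfolding integrand_def by (simp only: plus_complex.sel)
  qed
  moreover have "(\<lambda>\<theta>. Re (integrand 0 t x \<theta> \<omega>)) integrable_on {0..1}"
    using integrable_linear[OF int bounded_linear_Re] by (simp add: comp_def)
  ultimately have "integral {0..1} (\<lambda>\<theta>. Re (integrand 0 t x \<theta> \<omega>)) \<le> integral {0..1::real} (\<lambda>_. 0::real)"
    by (intro integral_le) auto
  then show ?thesis
    using integral_linear[OF int bounded_linear_Re] by (simp add: comp_def exponent_def)
qed

end

context gaussian_functional
begin

text \<open>The derivatives of \<open>exp (exponent 0)\<close> with respect to the initial value are products of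
  \<open>exp (exponent 0)\<close> with polynomials in the functionals \<open>exponent 1\<close>, \<open>exponent 2\<close> and so on.\<close>
inductive exponent_poly :: "(real \<Rightarrow> real \<Rightarrow> 'a \<Rightarrow> complex) \<Rightarrow> bool" where
  zero: "exponent_poly (\<lambda>t x \<omega>. 0)"
| one: "exponent_poly (\<lambda>t x \<omega>. 1)"
| mult: "exponent_poly P \<Longrightarrow> exponent_poly (\<lambda>t x \<omega>. exponent (Suc n) t x \<omega> * P t x \<omega>)"
| add: "exponent_poly P \<Longrightarrow> exponent_poly Q \<Longrightarrow> exponent_poly (\<lambda>t x \<omega>. P t x \<omega> + Q t x \<omega>)"

section \<open>Calculus of polynomials in the derivatives of the exponent, and their weighted
  expectations\<close>

lemma exponent_poly_continuous:
  assumes "exponent_poly P" "\<omega> \<in> space M"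
  shows "continuous_on ({0..T} \<times> UNIV) (\<lambda>z. P (fst z) (snd z) \<omega>)"
  using assms
  by (induction rule: exponent_poly.induct) (auto intro!: continuous_intros exponent_continuous)

lemma exponent_poly_measurable:
  assumes "exponent_poly P" "t \<in> {0..T}"
  shows "P t x \<in> borel_measurable M"
  using assms
  by (induction rule: exponent_poly.induct)
    (auto intro!: borel_measurable_add borel_measurable_times exponent_measurable)

lemma exponent_poly_derivative:
  assumes "exponent_poly P"
  obtains P' where "exponent_poly P'"
    "\<And>t x \<omega>. t \<in> {0..T} \<Longrightarrow> \<omega> \<in> space M \<Longrightarrow> ((\<lambda>x. P t x \<omega>) has_vector_derivative P' t x \<omega>) (at x)"
proof -
  have "\<exists>P'. exponent_poly P' \<and> (\<forall>t\<in>{0..T}. \<forall>x. \<forall>\<omega>\<in>space M.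
      ((\<lambda>x. P t x \<omega>) has_vector_derivative P' t x \<omega>) (at x))"
    using assms
  proof (induction rule: exponent_poly.induct)
    case zero
    show ?case by (intro exI[of _ "\<lambda>t x \<omega>. 0"]) (auto intro: exponent_poly.zero)
  next
    case one
    show ?case by (intro exI[of _ "\<lambda>t x \<omega>. 0"]) (auto intro: exponent_poly.zero)
  next
    case (mult P n)
    then obtain P' where P': "exponent_poly P'" "\<And>t x \<omega>. t \<in> {0..T} \<Longrightarrow> \<omega> \<in> space M \<Longrightarrow>
        ((\<lambda>x. P t x \<omega>) has_vector_derivative P' t x \<omega>) (at x)" by blast
    have "((\<lambda>x. exponent (Suc n) t x \<omega> * P t x \<omega>) has_vector_derivative
        exponent (Suc n) t x \<omega> * P' t x \<omega> + exponent (Suc (Suc n)) t x \<omega> * P t x \<omega>) (at x)"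
      if "t \<in> {0..T}" "\<omega> \<in> space M" for t x \<omega>
      by (intro has_vector_derivative_mult exponent_derivative P'(2) that)
    moreover have "exponent_poly (\<lambda>t x \<omega>. exponent (Suc n) t x \<omega> * P' t x \<omega> + exponent (Suc (Suc n)) t x \<omega> * P t x \<omega>)"
      by (intro exponent_poly.add exponent_poly.mult P'(1) mult.hyps)
    ultimately show ?case by blast
  next
    case (add P Q)
    obtain P' where P': "exponent_poly P'" "\<And>t x \<omega>. t \<in> {0..T} \<Longrightarrow> \<omega> \<in> space M \<Longrightarrow>
        ((\<lambda>x. P t x \<omega>) has_vector_derivative P' t x \<omega>) (at x)" using add.IH(1) by blast
    obtain Q' where Q': "exponent_poly Q'" "\<And>t x \<omega>. t \<in> {0..T} \<Longrightarrow> \<omega> \<in> space M \<Longrightarrow>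
        ((\<lambda>x. Q t x \<omega>) has_vector_derivative Q' t x \<omega>) (at x)" using add.IH(2) by blast
    have "((\<lambda>x. P t x \<omega> + Q t x \<omega>) has_vector_derivative P' t x \<omega> + Q' t x \<omega>) (at x)"
      if "t \<in> {0..T}" "\<omega> \<in> space M" for t x \<omega>
      by (intro has_vector_derivative_add P'(2) Q'(2) that)
    moreover have "exponent_poly (\<lambda>t x \<omega>. P' t x \<omega> + Q' t x \<omega>)"
      by (intro exponent_poly.add P'(1) Q'(1))
    ultimately show ?case by blast
  qed
  with that show ?thesis by blast
qed

lemma exponent_poly_bound:
  assumes "exponent_poly P"
  obtains h where "negligible_dfact h"
    "\<And>t x \<omega>. t \<in> {0..T} \<Longrightarrow> \<omega> \<in> space M \<Longrightarrow> norm (P t x \<omega>) \<le> ps_abs_eval h (\<bar>x\<bar> + D \<omega>)"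
proof -
  have "\<exists>h. negligible_dfact h \<and> (\<forall>t\<in>{0..T}. \<forall>x. \<forall>\<omega>\<in>space M. norm (P t x \<omega>) \<le> ps_abs_eval h (\<bar>x\<bar> + D \<omega>))"
    using assms
  proof (induction rule: exponent_poly.induct)
    case zero
    have n: "negligible_dfact (\<lambda>k. 0)" by (rule negligible_dfact_finite[of 0]) simp
    then show ?case using D_nonneg by (intro exI[of _ "\<lambda>k. 0"]) (auto intro!: ps_abs_eval_nonneg)
  next
    case one
    define h :: "nat \<Rightarrow> real" where "h k = (if k = 0 then 1 else 0)" for k
    have n: "negligible_dfact h" by (rule negligible_dfact_finite[of 1]) (auto simp: h_def)
    have "ps_abs_eval h y = 1" for y
    proof -
      have "ps_abs_eval h y = (\<Sum>k\<in>{0}. \<bar>h k\<bar> * y ^ k)"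
        unfolding ps_abs_eval_def by (rule suminf_finite) (auto simp: h_def)
      then show ?thesis by (simp add: h_def)
    qed
    then show ?case using n by (intro exI[of _ h]) auto
  next
    case (mult P n)
    then obtain h where h: "negligible_dfact h" "\<And>t x \<omega>. t \<in> {0..T} \<Longrightarrow> \<omega> \<in> space M \<Longrightarrow>
        norm (P t x \<omega>) \<le> ps_abs_eval h (\<bar>x\<bar> + D \<omega>)" by blast
    obtain g where g: "negligible_dfact g" "\<And>t x \<omega>. t \<in> {0..T} \<Longrightarrow> \<omega> \<in> space M \<Longrightarrow>
        norm (exponent (Suc n) t x \<omega>) \<le> ps_abs_eval g (\<bar>x\<bar> + D \<omega>)"
      using exponent_bound[of "Suc n"] by blast
    have "norm (exponent (Suc n) t x \<omega> * P t x \<omega>)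
        \<le> ps_abs_eval (ps_mult (\<lambda>k. \<bar>g k\<bar>) (\<lambda>k. \<bar>h k\<bar>)) (\<bar>x\<bar> + D \<omega>)"
      if "t \<in> {0..T}" "\<omega> \<in> space M" for t x \<omega>
      unfolding norm_mult ps_abs_eval_mult[OF g(1) h(1)]
      using D_nonneg[OF that(2)]
      by (intro mult_mono g(2) h(2) that ps_abs_eval_nonneg g(1) norm_ge_zero) auto
    moreover have "negligible_dfact (ps_mult (\<lambda>k. \<bar>g k\<bar>) (\<lambda>k. \<bar>h k\<bar>))"
      by (intro negligible_dfact_mult negligible_dfact_abs g(1) h(1))
    ultimately show ?case by blast
  next
    case (add P Q)
    obtain g where g: "negligible_dfact g" "\<And>t x \<omega>. t \<in> {0..T} \<Longrightarrow> \<omega> \<in> space M \<Longrightarrow>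
        norm (P t x \<omega>) \<le> ps_abs_eval g (\<bar>x\<bar> + D \<omega>)" using add.IH(1) by blast
    obtain h where h: "negligible_dfact h" "\<And>t x \<omega>. t \<in> {0..T} \<Longrightarrow> \<omega> \<in> space M \<Longrightarrow>
        norm (Q t x \<omega>) \<le> ps_abs_eval h (\<bar>x\<bar> + D \<omega>)" using add.IH(2) by blast
    have "norm (P t x \<omega> + Q t x \<omega>) \<le> ps_abs_eval (\<lambda>k. \<bar>g k\<bar> + \<bar>h k\<bar>) (\<bar>x\<bar> + D \<omega>)"
      if "t \<in> {0..T}" "\<omega> \<in> space M" for t x \<omega>
      unfolding ps_abs_eval_add[OF g(1) h(1)]
      by (intro norm_triangle_le add_mono g(2) h(2) that)
    moreover have "negligible_dfact (\<lambda>k. \<bar>g k\<bar> + \<bar>h k\<bar>)"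
      by (intro negligible_dfact_add negligible_dfact_abs g(1) h(1))
    ultimately show ?case by blast
  qed
  with that show ?thesis by blast
qed

text \<open>Here r bounds the modulus of the starting point: at one point, on a unit ball, or along
  a convergent sequence. In the second claim the integral on the right is free of r and becomes the
  constant \<open>Ck\<close>.\<close>

lemma integrable_dominating:
  assumes h: "negligible_dfact h" and r: "0 \<le> r"
  shows "integrable M (\<lambda>\<omega>. ps_abs_eval h (r + D \<omega>))"
    "(\<integral>\<omega>. ps_abs_eval h (r + D \<omega>) \<partial>M)
      \<le> ps_abs_eval (\<lambda>k. h k * 2 ^ k) r + (\<integral>\<omega>. ps_abs_eval (\<lambda>k. h k * 2 ^ k) (D \<omega>) \<partial>M)"
proof -
  let ?h2 = "\<lambda>k. h k * 2 ^ k"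
  have h2: "negligible_dfact ?h2" by (rule negligible_dfact_scale[OF h])
  have [measurable]: "ps_abs_eval h \<in> borel_measurable borel" "D \<in> borel_measurable M"
    by (intro borel_measurable_continuous_onI continuous_on_ps_abs_eval h D_meas)+
  have int: "integrable M (\<lambda>\<omega>. ps_abs_eval ?h2 r + ps_abs_eval ?h2 (D \<omega>))"
    using D_int[OF h2] by simp
  have le: "ps_abs_eval h (r + D \<omega>) \<le> ps_abs_eval ?h2 r + ps_abs_eval ?h2 (D \<omega>)" if "\<omega> \<in> space M" for \<omega>
    by (rule ps_abs_eval_sum_le[OF h r D_nonneg[OF that]])
  have nonneg: "0 \<le> ps_abs_eval h (r + D \<omega>)" if "\<omega> \<in> space M" for \<omega>
    using r D_nonneg[OF that] by (intro ps_abs_eval_nonneg[OF h]) auto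
  show "integrable M (\<lambda>\<omega>. ps_abs_eval h (r + D \<omega>))"
  proof (rule Bochner_Integration.integrable_bound[OF int])
    show "AE \<omega> in M. norm (ps_abs_eval h (r + D \<omega>)) \<le> norm (ps_abs_eval ?h2 r + ps_abs_eval ?h2 (D \<omega>))"
      using le nonneg by (intro AE_I2) (auto intro: order_trans[OF _ abs_ge_self])
  qed measurable
  then have "(\<integral>\<omega>. ps_abs_eval h (r + D \<omega>) \<partial>M) \<le> (\<integral>\<omega>. ps_abs_eval ?h2 r + ps_abs_eval ?h2 (D \<omega>) \<partial>M)"
    by (rule integral_mono[OF _ int le])
  also have "\<dots> = ps_abs_eval ?h2 r + (\<integral>\<omega>. ps_abs_eval ?h2 (D \<omega>) \<partial>M)"
    using D_int[OF h2] by (simp add: prob_space)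
  finally show "(\<integral>\<omega>. ps_abs_eval h (r + D \<omega>) \<partial>M) \<le> ps_abs_eval ?h2 r + (\<integral>\<omega>. ps_abs_eval ?h2 (D \<omega>) \<partial>M)" .
qed

text \<open>With \<open>P\<close> ranging over \<open>exponent_poly\<close>, these functions form a
  class that contains \<open>f\<close> (for \<open>P = 1\<close>) and is closed under
  differentiation in x; the induction on the order of the derivative runs inside this class.\<close>

definition expect :: "(real \<Rightarrow> real \<Rightarrow> 'a \<Rightarrow> complex) \<Rightarrow> real \<Rightarrow> real \<Rightarrow> complex" where
  "expect P t x = (\<integral>\<omega>. exp (exponent 0 t x \<omega>) * P t x \<omega> \<partial>M)"

lemma norm_exp_exponent_mult_le:
  assumes "t \<in> {0..T}" "\<omega> \<in> space M"
  shows "norm (exp (exponent 0 t x \<omega>) * z) \<le> norm z"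
  using Re_exponent_le[OF assms, of x] mult_right_mono[of "exp (Re (exponent 0 t x \<omega>))" 1 "norm z"]
  by (simp add: norm_mult)

lemma weighted_measurable:
  assumes "exponent_poly P" "t \<in> {0..T}"
  shows "(\<lambda>\<omega>. exp (exponent 0 t x \<omega>) * P t x \<omega>) \<in> borel_measurable M"
proof -
  have [measurable]: "exponent 0 t x \<in> borel_measurable M" "P t x \<in> borel_measurable M"
    by (intro exponent_measurable exponent_poly_measurable assms)+
  show ?thesis by measurable
qed

lemma weighted_bound:
  assumes "exponent_poly P"
  obtains h where "negligible_dfact h"
    "\<And>t x \<omega>. t \<in> {0..T} \<Longrightarrow> \<omega> \<in> space M \<Longrightarrow>
       norm (exp (exponent 0 t x \<omega>) * P t x \<omega>) \<le> ps_abs_eval h (\<bar>x\<bar> + D \<omega>)"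
proof -
  obtain h where h: "negligible_dfact h"
    "\<And>t x \<omega>. t \<in> {0..T} \<Longrightarrow> \<omega> \<in> space M \<Longrightarrow> norm (P t x \<omega>) \<le> ps_abs_eval h (\<bar>x\<bar> + D \<omega>)"
    using exponent_poly_bound[OF assms] by blast
  have "norm (exp (exponent 0 t x \<omega>) * P t x \<omega>) \<le> ps_abs_eval h (\<bar>x\<bar> + D \<omega>)"
    if "t \<in> {0..T}" "\<omega> \<in> space M" for t x \<omega>
    using norm_exp_exponent_mult_le[OF that] h(2)[OF that] order_trans by blast
  with h(1) that show ?thesis by blast
qed

lemma weighted_integrable:
  assumes P: "exponent_poly P" and t: "t \<in> {0..T}"
  shows "integrable M (\<lambda>\<omega>. exp (exponent 0 t x \<omega>) * P t x \<omega>)"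
proof -
  obtain h where h: "negligible_dfact h" "\<And>t x \<omega>. t \<in> {0..T} \<Longrightarrow> \<omega> \<in> space M \<Longrightarrow>
       norm (exp (exponent 0 t x \<omega>) * P t x \<omega>) \<le> ps_abs_eval h (\<bar>x\<bar> + D \<omega>)"
    using weighted_bound[OF P] by blast
  show ?thesis
  proof (rule Bochner_Integration.integrable_bound[OF integrable_dominating(1)[OF h(1) abs_ge_zero[of x]]])
    show "AE \<omega> in M. norm (exp (exponent 0 t x \<omega>) * P t x \<omega>) \<le> norm (ps_abs_eval h (\<bar>x\<bar> + D \<omega>))"
      using h(2)[OF t] by (intro AE_I2) (auto intro: order_trans[OF _ abs_ge_self])
  qed (rule weighted_measurable[OF P t])
qed

lemma expect_bound:
  assumes P: "exponent_poly P"
  shows "\<exists>qk Ck. negligible_dfact qk \<and> (\<forall>t\<in>{0..T}. \<forall>x. norm (expect P t x) \<le> ps_abs_eval qk \<bar>x\<bar> + Ck)"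
proof -
  obtain h where h: "negligible_dfact h" "\<And>t x \<omega>. t \<in> {0..T} \<Longrightarrow> \<omega> \<in> space M \<Longrightarrow>
       norm (exp (exponent 0 t x \<omega>) * P t x \<omega>) \<le> ps_abs_eval h (\<bar>x\<bar> + D \<omega>)"
    using weighted_bound[OF P] by blast
  have "norm (expect P t x) \<le> ps_abs_eval (\<lambda>k. h k * 2 ^ k) \<bar>x\<bar> + (\<integral>\<omega>. ps_abs_eval (\<lambda>k. h k * 2 ^ k) (D \<omega>) \<partial>M)"
    if t: "t \<in> {0..T}" for t x
  proof -
    have "norm (expect P t x) \<le> (\<integral>\<omega>. norm (exp (exponent 0 t x \<omega>) * P t x \<omega>) \<partial>M)"
      unfolding expect_def by (rule integral_norm_bound)
    also have "\<dots> \<le> (\<integral>\<omega>. ps_abs_eval h (\<bar>x\<bar> + D \<omega>) \<partial>M)"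
      by (intro integral_mono integrable_norm weighted_integrable[OF P t]
          integrable_dominating(1)[OF h(1) abs_ge_zero] h(2)[OF t])
    also note integrable_dominating(2)[OF h(1) abs_ge_zero[of x]]
    finally show ?thesis .
  qed
  with negligible_dfact_scale[OF h(1), of 2] show ?thesis by blast
qed

lemma expect_continuous:
  assumes P: "exponent_poly P"
  shows "continuous_on ({0..T} \<times> UNIV) (\<lambda>(t, x). expect P t x)"
proof (rule continuous_on_sequentiallyI)
  fix z :: "nat \<Rightarrow> real \<times> real" and z0
  assume z: "\<forall>n. z n \<in> {0..T} \<times> UNIV" "z0 \<in> {0..T} \<times> UNIV" "z \<longlonglongrightarrow> z0"
  obtain h where h: "negligible_dfact h" "\<And>t x \<omega>. t \<in> {0..T} \<Longrightarrow> \<omega> \<in> space M \<Longrightarrow>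
       norm (exp (exponent 0 t x \<omega>) * P t x \<omega>) \<le> ps_abs_eval h (\<bar>x\<bar> + D \<omega>)"
    using weighted_bound[OF P] by blast
  have zt: "fst (z n) \<in> {0..T}" "fst z0 \<in> {0..T}" for n using z(1,2) by (auto simp: mem_Times_iff)
  have "Bseq (\<lambda>n. snd (z n))"
    using tendsto_snd[OF z(3)] by (intro convergent_imp_Bseq convergentI)
  then obtain r where r: "0 < r" "\<And>n. \<bar>snd (z n)\<bar> \<le> r" unfolding Bseq_def by auto
  have "(\<lambda>n. \<integral>\<omega>. exp (exponent 0 (fst (z n)) (snd (z n)) \<omega>) * P (fst (z n)) (snd (z n)) \<omega> \<partial>M)
      \<longlonglongrightarrow> (\<integral>\<omega>. exp (exponent 0 (fst z0) (snd z0) \<omega>) * P (fst z0) (snd z0) \<omega> \<partial>M)"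
  proof (rule integral_dominated_convergence[OF _ _ integrable_dominating(1)[OF h(1), of r]])
    show "AE \<omega> in M. (\<lambda>n. exp (exponent 0 (fst (z n)) (snd (z n)) \<omega>) * P (fst (z n)) (snd (z n)) \<omega>)
        \<longlonglongrightarrow> exp (exponent 0 (fst z0) (snd z0) \<omega>) * P (fst z0) (snd z0) \<omega>"
    proof (rule AE_I2)
      fix \<omega> assume \<omega>: "\<omega> \<in> space M"
      have "continuous_on ({0..T} \<times> UNIV) (\<lambda>z. exp (exponent 0 (fst z) (snd z) \<omega>) * P (fst z) (snd z) \<omega>)"
        by (intro continuous_intros exponent_continuous exponent_poly_continuous P \<omega>)
      then show "(\<lambda>n. exp (exponent 0 (fst (z n)) (snd (z n)) \<omega>) * P (fst (z n)) (snd (z n)) \<omega>)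
        \<longlonglongrightarrow> exp (exponent 0 (fst z0) (snd z0) \<omega>) * P (fst z0) (snd z0) \<omega>"
        by (rule continuous_on_tendsto_compose) (use z in auto)
    qed
    show "AE \<omega> in M. norm (exp (exponent 0 (fst (z n)) (snd (z n)) \<omega>) * P (fst (z n)) (snd (z n)) \<omega>)
        \<le> ps_abs_eval h (r + D \<omega>)" for n
    proof (rule AE_I2)
      fix \<omega> assume \<omega>: "\<omega> \<in> space M"
      have "ps_abs_eval h (\<bar>snd (z n)\<bar> + D \<omega>) \<le> ps_abs_eval h (r + D \<omega>)"
        using r(2)[of n] D_nonneg[OF \<omega>] by (intro ps_abs_eval_mono[OF h(1)]) auto
      with h(2)[OF zt(1)[of n] \<omega>]
      show "norm (exp (exponent 0 (fst (z n)) (snd (z n)) \<omega>) * P (fst (z n)) (snd (z n)) \<omega>)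
          \<le> ps_abs_eval h (r + D \<omega>)" using order_trans by blast
    qed
  qed (use r(1) in \<open>auto intro!: weighted_measurable[OF P] zt simp del: atLeastAtMost_iff\<close>)
  then show "(\<lambda>n. case z n of (t, x) \<Rightarrow> expect P t x) \<longlonglongrightarrow> (case z0 of (t, x) \<Rightarrow> expect P t x)"
    by (simp add: expect_def case_prod_beta)
qed

lemma expect_derivative:
  assumes P: "exponent_poly P"
  obtains Q where "exponent_poly Q"
    "\<And>t x. t \<in> {0..T} \<Longrightarrow> ((\<lambda>x. expect P t x) has_vector_derivative expect Q t x) (at x)"
proof -
  obtain P' where P': "exponent_poly P'"
    "\<And>t x \<omega>. t \<in> {0..T} \<Longrightarrow> \<omega> \<in> space M \<Longrightarrow> ((\<lambda>x. P t x \<omega>) has_vector_derivative P' t x \<omega>) (at x)"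
    using exponent_poly_derivative[OF P] by blast
  \<comment> \<open>The product rule with the common factor
    \<open>exp (exponent 0 t x \<omega>)\<close> taken out.\<close>
  define Q where "Q t x \<omega> = exponent (Suc 0) t x \<omega> * P t x \<omega> + P' t x \<omega>" for t x \<omega>
  have Q: "exponent_poly Q"
    unfolding Q_def by (intro exponent_poly.add exponent_poly.mult P P'(1))
  obtain h where h: "negligible_dfact h" "\<And>t x \<omega>. t \<in> {0..T} \<Longrightarrow> \<omega> \<in> space M \<Longrightarrow>
       norm (exp (exponent 0 t x \<omega>) * Q t x \<omega>) \<le> ps_abs_eval h (\<bar>x\<bar> + D \<omega>)"
    using weighted_bound[OF Q] by blast
  have "((\<lambda>x. expect P t x) has_vector_derivative expect Q t x) (at x)" if t: "t \<in> {0..T}" for t x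
    unfolding expect_def
  proof (rule has_vector_derivative_integral_dominated)
    show "((\<lambda>y. exp (exponent 0 t y \<omega>) * P t y \<omega>) has_vector_derivative exp (exponent 0 t y \<omega>) * Q t y \<omega>) (at y)"
      if \<omega>: "\<omega> \<in> space M" for y \<omega>
    proof -
      have "((\<lambda>y. exp (exponent 0 t y \<omega>)) has_vector_derivative
          exponent (Suc 0) t y \<omega> * exp (exponent 0 t y \<omega>)) (at y)"
        using field_vector_diff_chain_at[OF exponent_derivative[OF \<omega> t, of 0 y] DERIV_exp]
        by (simp add: comp_def)
      from has_vector_derivative_mult[OF this P'(2)[OF t \<omega>, of y]]
      show ?thesis by (simp add: Q_def algebra_simps)
    qed
    show "norm (exp (exponent 0 t y \<omega>) * Q t y \<omega>) \<le> ps_abs_eval h ((\<bar>x\<bar> + 1) + D \<omega>)"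
      if "\<bar>y - x\<bar> \<le> 1" "\<omega> \<in> space M" for y \<omega>
    proof -
      have "ps_abs_eval h (\<bar>y\<bar> + D \<omega>) \<le> ps_abs_eval h ((\<bar>x\<bar> + 1) + D \<omega>)"
        using that D_nonneg[OF that(2)] by (intro ps_abs_eval_mono[OF h(1)]) auto
      with h(2)[OF t that(2), of y] show ?thesis by linarith
    qed
    show "integrable M (\<lambda>\<omega>. ps_abs_eval h ((\<bar>x\<bar> + 1) + D \<omega>))"
      by (rule integrable_dominating(1)[OF h(1)]) simp
  qed (intro weighted_integrable[OF P t] weighted_measurable[OF Q t])+
  with Q that show ?thesis by blast
qed

lemma xderiv_expect:
  assumes f: "\<And>t x. t \<in> {0..T} \<Longrightarrow> f t x = expect (\<lambda>t x \<omega>. 1) t x"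
  shows "\<exists>P. exponent_poly P \<and> (\<forall>t\<in>{0..T}. \<forall>x. xderiv k f t x = expect P t x)"
proof (induction k)
  case 0
  then show ?case using f exponent_poly.one by (intro exI[of _ "\<lambda>t x \<omega>. 1"]) auto
next
  case (Suc k)
  then obtain P where P: "exponent_poly P" "\<And>t x. t \<in> {0..T} \<Longrightarrow> xderiv k f t x = expect P t x" by blast
  obtain Q where Q: "exponent_poly Q"
    "\<And>t x. t \<in> {0..T} \<Longrightarrow> ((\<lambda>x. expect P t x) has_vector_derivative expect Q t x) (at x)"
    using expect_derivative[OF P(1)] by blast
  have "xderiv (Suc k) f t x = expect Q t x" if t: "t \<in> {0..T}" for t x
  proof -
    \<comment> \<open>Equality of whole functions of x is needed, since
      \<open>vector_derivative\<close> looks at a neighbourhood of x. It involves this t alone, so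
      nothing is required of times outside \<open>{0..T}\<close>.\<close>
    have "xderiv k f t = expect P t" using P(2)[OF t] by (rule ext)
    then show ?thesis using vector_derivative_at[OF Q(2)[OF t, of x]] by simp
  qed
  with Q(1) show ?case by blast
qed

text \<open>Undoes the rescaling: the substitution \<open>s = t + \<theta> * (T - t)\<close> has
  Jacobian \<open>T - t\<close>, which is the prefactor in \<open>integrand\<close>.\<close>

lemma exponent_0_eq:
  assumes t: "t \<in> {0..T}" and \<omega>: "\<omega> \<in> space M"
  shows "exponent 0 t x \<omega> = integral {t..T} (\<lambda>s. u1 s * complex_of_real (ps_eval p1 (flow t x s \<omega>))
      + u2 s * complex_of_real (ps_eval p2 (flow t x s \<omega>)) + u3 s * complex_of_real (ps_eval p3 (flow t x s \<omega>)))
    + w * complex_of_real (ps_eval q (flow t x T \<omega>))"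
proof -
  define g where "g s = summand u1 p1 0 t x s \<omega> + summand u2 p2 0 t x s \<omega> + summand u3 p3 0 t x s \<omega>" for s
  have tT: "s \<in> {0..T}" if "s \<in> {t..T}" for s using that t by auto
  have "continuous_on {t..T} g"
    unfolding g_def
    by (intro continuous_on_add summand_continuous negl u_cont \<omega> continuous_on_const continuous_on_id t tT)
  moreover have "((\<lambda>\<theta>. t + \<theta> * (T - t)) has_field_derivative T - t) (at \<theta> within {0..1})" for \<theta>
    by (auto intro!: derivative_eq_intros)
  moreover have "(\<lambda>\<theta>. t + \<theta> * (T - t)) ` {0..1} \<subseteq> {t..T}"
  proof safe
    fix \<theta> :: real assume "\<theta> \<in> {0..1}"
    moreover from this have "0 \<le> \<theta> * (T - t)" using t by (intro mult_nonneg_nonneg) auto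
    ultimately show "t + \<theta> * (T - t) \<in> {t..T}" using rescaled_time[OF t] by auto
  qed
  ultimately have "((\<lambda>\<theta>. (T - t) *\<^sub>R g (t + \<theta> * (T - t))) has_integral integral {t..T} g) {0..1}"
    using has_integral_substitution[of 0 1 "\<lambda>\<theta>. t + \<theta> * (T - t)" t T g "\<lambda>_. T - t"] t by simp
  from has_integral_add[OF this has_integral_const_real[of "summand (\<lambda>_. w) q 0 t x T \<omega>" 0 1]]
  have "((\<lambda>\<theta>. integrand 0 t x \<theta> \<omega>) has_integral integral {t..T} g + summand (\<lambda>_. w) q 0 t x T \<omega>) {0..1}"
    unfolding integrand_def g_def by (simp add: scaleR_conv_of_real)
  then show ?thesis
    unfolding exponent_def by (simp add: integral_unique g_def[abs_def] summand_def)
qed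

theorem smooth_expectation:
  assumes f: "\<And>t x. t \<in> {0..T} \<Longrightarrow> f t x = expect (\<lambda>t x \<omega>. 1) t x"
  shows "(\<forall>t\<in>{0..T}. \<forall>x. ((\<lambda>y. xderiv k f t y) has_vector_derivative xderiv (Suc k) f t x) (at x))
    \<and> continuous_on ({0..T} \<times> UNIV) (\<lambda>(t, x). xderiv k f t x)
    \<and> (\<exists>qk Ck. negligible_dfact qk \<and> (\<forall>t\<in>{0..T}. \<forall>x. norm (xderiv k f t x) \<le> ps_abs_eval qk \<bar>x\<bar> + Ck))"
proof -
  obtain P where P: "exponent_poly P" "\<And>t x. t \<in> {0..T} \<Longrightarrow> xderiv k f t x = expect P t x"
    using xderiv_expect[where f=f and k=k] f by blast
  obtain Q where Q: "\<And>t x. t \<in> {0..T} \<Longrightarrow> ((\<lambda>x. expect P t x) has_vector_derivative expect Q t x) (at x)"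
    using expect_derivative[OF P(1)] by blast
  have "((\<lambda>y. xderiv k f t y) has_vector_derivative xderiv (Suc k) f t x) (at x)" if t: "t \<in> {0..T}" for t x
  proof -
    have "xderiv k f t = expect P t" using P(2)[OF t] by (rule ext)
    then show ?thesis using Q[OF t, of x] vector_derivative_at[OF Q[OF t, of x]] by simp
  qed
  moreover have "continuous_on ({0..T} \<times> UNIV) (\<lambda>(t, x). xderiv k f t x)"
    using expect_continuous[OF P(1)] by (rule continuous_on_eq) (auto simp: P(2))
  moreover have "\<exists>qk Ck. negligible_dfact qk \<and> (\<forall>t\<in>{0..T}. \<forall>x. norm (xderiv k f t x) \<le> ps_abs_eval qk \<bar>x\<bar> + Ck)"
  proof -
    obtain qk Ck where "negligible_dfact qk" "\<And>t x. t \<in> {0..T} \<Longrightarrow> norm (expect P t x) \<le> ps_abs_eval qk \<bar>x\<bar> + Ck"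
      using expect_bound[OF P(1)] by blast
    then show ?thesis using P(2) by (intro exI[of _ qk] exI[of _ Ck]) auto
  qed
  ultimately show ?thesis by blast
qed

end

section \<open>Linear equations and affine moments\<close>

text \<open>The integrating factor \<open>exp (- b * (s - t))\<close> turns the linear equation into
  one whose two sides have equal derivatives. It is applied to a solution with its noise subtracted,
  and, with \<open>g = 0\<close>, to the difference of two solutions.\<close>

lemma variation_of_constants:
  fixes y g :: "real \<Rightarrow> real"
  assumes y: "continuous_on {t..T} y" and g: "continuous_on {t..T} g"
    and eq: "\<And>s. s \<in> {t..T} \<Longrightarrow> y s = y0 + integral {t..s} (\<lambda>r. g r + b * y r)"
    and s: "s \<in> {t..T}"
  shows "y s = exp (b * (s - t)) * (y0 + integral {t..s} (\<lambda>r. exp (- b * (r - t)) * g r))"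
proof -
  \<comment> \<open>The right-hand side of the equation, rather than y, is what gets differentiated:
    the fundamental theorem applies to it, and on \<open>{t..T}\<close> both have the same
    values.\<close>
  define Y where "Y s = y0 + integral {t..s} (\<lambda>r. g r + b * y r)" for s
  define I where "I s = integral {t..s} (\<lambda>r. exp (- b * (r - t)) * g r)" for s
  have "((\<lambda>s. exp (- b * (s - t)) * Y s - I s) has_field_derivative 0) (at s within {t..T})"
    if s: "s \<in> {t..T}" for s
  proof -
    have "((\<lambda>s. integral {t..s} (\<lambda>r. g r + b * y r)) has_real_derivative g s + b * y s) (at s within {t..T})"
      by (intro integral_has_real_derivative continuous_intros y g s)
    then have dY: "(Y has_real_derivative g s + b * Y s) (at s within {t..T})"
      unfolding Y_def using eq[OF s] by (auto intro!: derivative_eq_intros)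
    have dI: "(I has_real_derivative exp (- b * (s - t)) * g s) (at s within {t..T})"
      unfolding I_def by (intro integral_has_real_derivative continuous_intros g s)
    show ?thesis
      by (rule derivative_eq_intros dY dI refl | simp add: algebra_simps)+
  qed
  then obtain C where C: "\<And>s. s \<in> {t..T} \<Longrightarrow> exp (- b * (s - t)) * Y s - I s = C"
    using has_field_derivative_zero_constant[of "{t..T}" "\<lambda>s. exp (- b * (s - t)) * Y s - I s"] by auto
  have "t \<in> {t..T}" using s by simp
  from C[OF this] C[OF s] have "exp (- b * (s - t)) * Y s = y0 + I s" by (simp add: Y_def I_def)
  then have "exp (b * (s - t)) * (exp (- b * (s - t)) * Y s) = exp (b * (s - t)) * (y0 + I s)" by simp
  moreover have "exp (b * (s - t)) * (exp (- b * (s - t)) * Y s) = Y s"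
    by (simp flip: mult.assoc exp_add)
  ultimately show ?thesis using eq[OF s] by (simp add: Y_def I_def)
qed

text \<open>By \<open>power_add_le_2_power\<close> the constant and the random part separate. The
  factor 3 is 1 for the constant part plus the 2 in the moments of \<open>S\<close>; the constant
  part also fits under the double factorial because that is at least 1.\<close>

lemma affine_moment_le:
  fixes S :: "'a \<Rightarrow> real"
  assumes "prob_space M" and S0: "\<And>\<omega>. 0 \<le> S \<omega>"
    and Sm: "S \<in> borel_measurable M"
    and int: "\<And>k. integrable M (\<lambda>\<omega>. S \<omega> ^ k)"
    and le: "\<And>k. (\<integral>\<omega>. S \<omega> ^ k \<partial>M) \<le> 2 * (R ^ k * real (dfact (k - 1)))"
    and nonneg: "0 \<le> \<alpha>" "0 \<le> \<beta>" "0 \<le> R"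
  shows "integrable M (\<lambda>\<omega>. (\<alpha> + \<beta> * S \<omega>) ^ k)"
    "(\<integral>\<omega>. (\<alpha> + \<beta> * S \<omega>) ^ k \<partial>M) \<le> 3 * ((2 * (\<alpha> + \<beta> * R)) ^ k * real (dfact (k - 1)))"
proof -
  interpret prob_space M by fact
  note Sm[measurable]
  have pw: "(\<alpha> + \<beta> * S \<omega>) ^ k \<le> 2 ^ k * (\<alpha> ^ k + \<beta> ^ k * S \<omega> ^ k)" for \<omega>
    using power_add_le_2_power[of \<alpha> "\<beta> * S \<omega>" k] nonneg S0[of \<omega>] by (simp add: power_mult_distrib)
  have int2: "integrable M (\<lambda>\<omega>. 2 ^ k * (\<alpha> ^ k + \<beta> ^ k * S \<omega> ^ k))"
    using int[of k] by simp
  have pos: "0 \<le> (\<alpha> + \<beta> * S \<omega>) ^ k" for \<omega> using nonneg S0[of \<omega>] by simp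
  show int1: "integrable M (\<lambda>\<omega>. (\<alpha> + \<beta> * S \<omega>) ^ k)"
  proof (rule Bochner_Integration.integrable_bound[OF int2])
    show "AE \<omega> in M. norm ((\<alpha> + \<beta> * S \<omega>) ^ k) \<le> norm (2 ^ k * (\<alpha> ^ k + \<beta> ^ k * S \<omega> ^ k))"
      using pw pos by (intro AE_I2) (auto intro: order_trans[OF _ abs_ge_self])
  qed measurable
  have "(\<integral>\<omega>. (\<alpha> + \<beta> * S \<omega>) ^ k \<partial>M) \<le> (\<integral>\<omega>. 2 ^ k * (\<alpha> ^ k + \<beta> ^ k * S \<omega> ^ k) \<partial>M)"
    by (rule integral_mono[OF int1 int2 pw])
  also have "\<dots> = 2 ^ k * (\<alpha> ^ k + \<beta> ^ k * (\<integral>\<omega>. S \<omega> ^ k \<partial>M))"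
    using int[of k] by (simp add: prob_space)
  also have "\<dots> \<le> 2 ^ k * (\<alpha> ^ k * real (dfact (k - 1)) + \<beta> ^ k * (2 * (R ^ k * real (dfact (k - 1)))))"
    using nonneg le[of k] dfact_ge_1[of "k - 1"]
    by (intro mult_left_mono add_mono) (auto simp: mult_le_cancel_left1)
  also have "\<dots> = 2 ^ k * real (dfact (k - 1)) * (\<alpha> ^ k + 2 * (\<beta> * R) ^ k)"
    by (simp add: power_mult_distrib algebra_simps)
  also have "\<dots> \<le> 2 ^ k * real (dfact (k - 1)) * (3 * (\<alpha> + \<beta> * R) ^ k)"
  proof (rule mult_left_mono)
    have "\<alpha> ^ k \<le> (\<alpha> + \<beta> * R) ^ k" "(\<beta> * R) ^ k \<le> (\<alpha> + \<beta> * R) ^ k"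
      using nonneg by (auto intro!: power_mono)
    then show "\<alpha> ^ k + 2 * (\<beta> * R) ^ k \<le> 3 * (\<alpha> + \<beta> * R) ^ k" by linarith
  qed simp
  also have "\<dots> = 3 * ((2 * (\<alpha> + \<beta> * R)) ^ k * real (dfact (k - 1)))"
    by (simp only: power_mult_distrib) simp
  finally show "(\<integral>\<omega>. (\<alpha> + \<beta> * S \<omega>) ^ k \<partial>M) \<le> 3 * ((2 * (\<alpha> + \<beta> * R)) ^ k * real (dfact (k - 1)))" .
qed

text \<open>Conditioning on the value x at time t is expressed by the solution \<open>X t x\<close>
  started there. As the diffusion coefficient is constant, the stochastic integral is
  \<open>c * (W s - W t)\<close> and the equation can be read path by path.\<close>

theorem theorem6p4:
  fixes M :: "'a measure" and F :: "real \<Rightarrow> 'a set set" and W :: "real \<Rightarrow> 'a \<Rightarrow> real"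
    and a b c T :: real
    and X :: "real \<Rightarrow> real \<Rightarrow> real \<Rightarrow> 'a \<Rightarrow> real"
    and u1 u2 u3 v :: "real \<Rightarrow> complex"
    and p p1 p2 p3 q :: "nat \<Rightarrow> real"
    and f :: "real \<Rightarrow> real \<Rightarrow> complex"
  assumes BM: "brownian_motion M F W"
    and c_ne: "c \<noteq> 0" and T_pos: "T > 0"
    and X_sol: "\<And>t x. t \<in> {0..T} \<Longrightarrow>
       AE \<omega> in M. continuous_on {t..T} (\<lambda>s. X t x s \<omega>) \<and>
         (\<forall>s\<in>{t..T}. X t x s \<omega> = x + integral {t..s} (\<lambda>r. a + b * X t x r \<omega>)
                                      + c * (W s \<omega> - W t \<omega>))"
    and cont: "continuous_on {0..T} u1" "continuous_on {0..T} u2"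
              "continuous_on {0..T} u3" "continuous_on {0..T} v"
    and re_u1: "\<And>s. s \<in> {0..T} \<Longrightarrow> Re (u1 s) \<le> 0"
    and re0: "\<And>s. s \<in> {0..T} \<Longrightarrow> Re (u2 s) = 0 \<and> Re (u3 s) = 0 \<and> Re (v s) = 0"
    and p1_def: "p1 = ps_mult p p"
    and negl: "negligible_dfact p" "negligible_dfact p2" "negligible_dfact p3" "negligible_dfact q"
    and f_def: "f = (\<lambda>t x. integral\<^sup>L M (\<lambda>\<omega>.
        exp (integral {t..T} (\<lambda>s. u1 s * complex_of_real (ps_eval p1 (X t x s \<omega>))
                                   + u2 s * complex_of_real (ps_eval p2 (X t x s \<omega>))
                                   + u3 s * complex_of_real (ps_eval p3 (X t x s \<omega>)))
             + v T * complex_of_real (ps_eval q (X t x T \<omega>)))))"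
  shows "\<forall>k. (\<forall>t\<in>{0..T}. \<forall>x. ((\<lambda>y. xderiv k f t y) has_vector_derivative xderiv (Suc k) f t x) (at x))
           \<and> continuous_on ({0..T} \<times> UNIV) (\<lambda>(t, x). xderiv k f t x)
           \<and> (\<exists>qk Ck. negligible_dfact qk \<and>
                (\<forall>t\<in>{0..T}. \<forall>x. norm (xderiv k f t x) \<le> ps_abs_eval qk \<bar>x\<bar> + Ck))"
proof -
  interpret prob_space M by (rule brownian_motionD(1)[OF BM])
  obtain S where S: "S \<in> borel_measurable M" "\<And>\<omega>. 0 \<le> S \<omega>"
    "AE \<omega> in M. \<forall>s\<in>{0..T}. \<bar>W s \<omega>\<bar> \<le> S \<omega>"
    "\<And>k. integrable M (\<lambda>\<omega>. S \<omega> ^ k)"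
    "\<And>k. (\<integral>\<omega>. S \<omega> ^ k \<partial>M) \<le> 2 * (sqrt T ^ k * real (dfact (k - 1)))"
    using brownian_motion_sup_moments[OF BM T_pos] by blast
  have "AE \<omega> in M. continuous_on {0..} (\<lambda>s. W s \<omega>) \<and> (\<forall>s\<in>{0..T}. \<bar>W s \<omega>\<bar> \<le> S \<omega>)"
    using brownian_motionD(4)[OF BM] S(3) by eventually_elim blast
  then obtain N where N: "N \<in> null_sets M"
    "{\<omega>\<in>space M. \<not> (continuous_on {0..} (\<lambda>s. W s \<omega>) \<and> (\<forall>s\<in>{0..T}. \<bar>W s \<omega>\<bar> \<le> S \<omega>))} \<subseteq> N"
    by (auto elim!: AE_E3)
  \<comment> \<open>On the exceptional set the path is replaced by 0, so that continuity and the
    bound by \<open>S\<close> hold for every outcome, as \<open>gaussian_functional\<close>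
    demands.\<close>
  define W' where "W' s \<omega> = (if \<omega> \<in> N then 0 else W s \<omega>)" for s \<omega>
  have W'_meas: "W' s \<in> borel_measurable M" if "s \<in> {0..T}" for s
  proof -
    have [measurable]: "N \<in> sets M" "W s \<in> borel_measurable M"
      using N(1) brownian_motion_borel_measurable[OF BM] that by auto
    show ?thesis unfolding W'_def by measurable
  qed
  have W'_cont: "continuous_on {0..T} (\<lambda>s. W' s \<omega>)" if "\<omega> \<in> space M" for \<omega>
  proof (cases "\<omega> \<in> N")
    case False
    then have "continuous_on {0..} (\<lambda>s. W s \<omega>)" using N(2) that by auto
    then have "continuous_on {0..T} (\<lambda>s. W s \<omega>)" by (rule continuous_on_subset) auto
    then show ?thesis using False by (simp add: W'_def)
  qed (simp add: W'_def)
  have W'_le: "\<bar>W' s \<omega>\<bar> \<le> S \<omega>" if "\<omega> \<in> space M" "s \<in> {0..T}" for s \<omega>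
  proof (cases "\<omega> \<in> N")
    case False
    then have "\<forall>s\<in>{0..T}. \<bar>W s \<omega>\<bar> \<le> S \<omega>" using N(2) that(1) by blast
    then show ?thesis using that(2) False by (simp add: W'_def)
  qed (simp add: W'_def S(2))
  \<comment> \<open>Subtracting the noise \<open>c * (W' s - W' 0)\<close> from the solution leaves
    a linear equation with continuous forcing \<open>g\<close>; \<open>U\<close> is its variation of
    constants formula with the noise added back.\<close>
  define g where "g r \<omega> = a + b * c * (W' r \<omega> - W' 0 \<omega>)" for r \<omega>
  define U where "U s \<omega> = exp (b * s) * integral {0..s} (\<lambda>r. exp (- b * r) * g r \<omega>) + c * (W' s \<omega> - W' 0 \<omega>)" for s \<omega>
  \<comment> \<open>\<open>E\<close> bounds each of the two exponentials in \<open>U\<close>;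
    \<open>\<alpha>\<close> and \<open>\<beta>\<close> collect the part free of \<open>S\<close> and
    the part linear in \<open>S\<close>, the factors 2 coming from the increment of
    \<open>W'\<close>.\<close>
  define E where "E = exp (\<bar>b\<bar> * T)"
  define \<alpha> where "\<alpha> = E * (E * \<bar>a\<bar> * T)"
  define \<beta> where "\<beta> = E * (E * (\<bar>b * c\<bar> * 2) * T) + \<bar>c\<bar> * 2"
  have E0: "0 \<le> E" by (simp add: E_def)
  have nonneg: "0 \<le> \<alpha>" "0 \<le> \<beta>" using E0 T_pos by (auto simp: \<alpha>_def \<beta>_def)
  have g_cont: "continuous_on {0..T} (\<lambda>r. exp (- b * r) * g r \<omega>)" if "\<omega> \<in> space M" for \<omega>
    unfolding g_def by (intro continuous_intros W'_cont that)
  have U_cont: "continuous_on {0..T} (\<lambda>s. U s \<omega>)" if "\<omega> \<in> space M" for \<omega>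
    unfolding U_def
    by (intro continuous_intros W'_cont that indefinite_integral_continuous_1
        integrable_continuous_interval g_cont)
  have U_meas: "U s \<in> borel_measurable M" if s: "s \<in> {0..T}" for s
  proof -
    have 0: "(0::real) \<in> {0..T}" using T_pos by simp
    have "(\<lambda>\<omega>. integral {0..s} (\<lambda>r. exp (- b * r) * g r \<omega>)) \<in> borel_measurable M"
    proof (rule borel_measurable_integral_continuous_paths)
      show "continuous_on {0..s} (\<lambda>r. exp (- b * r) * g r \<omega>)" if "\<omega> \<in> space M" for \<omega>
        by (rule continuous_on_subset[OF g_cont[OF that]]) (use s in auto)
      show "(\<lambda>\<omega>. exp (- b * r) * g r \<omega>) \<in> borel_measurable M" if "r \<in> {0..s}" for r
      proof -
        have [measurable]: "W' r \<in> borel_measurable M" "W' 0 \<in> borel_measurable M"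
          using W'_meas 0 that s by auto
        show ?thesis unfolding g_def by measurable
      qed
    qed
    moreover have "W' s \<in> borel_measurable M" "W' 0 \<in> borel_measurable M"
      using W'_meas 0 s by auto
    ultimately show ?thesis unfolding U_def by measurable
  qed
  have U_le: "\<bar>U s \<omega>\<bar> \<le> \<alpha> + \<beta> * S \<omega>" if s: "s \<in> {0..T}" and \<omega>: "\<omega> \<in> space M" for s \<omega>
  proof -
    have exp_le: "exp z \<le> E" if "\<bar>z\<bar> \<le> \<bar>b\<bar> * T" for z
      unfolding E_def using that by simp
    have b_le: "\<bar>b * r\<bar> \<le> \<bar>b\<bar> * T" if "r \<in> {0..T}" for r
      unfolding abs_mult using that by (intro mult_left_mono) auto
    have diff: "\<bar>W' r \<omega> - W' 0 \<omega>\<bar> \<le> 2 * S \<omega>" if "r \<in> {0..T}" for r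
      using W'_le[OF \<omega> that] W'_le[OF \<omega>, of 0] T_pos by auto
    have g_le: "\<bar>g r \<omega>\<bar> \<le> \<bar>a\<bar> + \<bar>b * c\<bar> * (2 * S \<omega>)" if "r \<in> {0..T}" for r
    proof -
      have "\<bar>g r \<omega>\<bar> \<le> \<bar>a\<bar> + \<bar>b * c\<bar> * \<bar>W' r \<omega> - W' 0 \<omega>\<bar>"
        unfolding g_def by (rule order_trans[OF abs_triangle_ineq]) (simp add: abs_mult)
      also have "\<dots> \<le> \<bar>a\<bar> + \<bar>b * c\<bar> * (2 * S \<omega>)"
        by (intro add_left_mono mult_left_mono diff that) simp
      finally show ?thesis .
    qed
    have "norm (integral {0..s} (\<lambda>r. exp (- b * r) * g r \<omega>)) \<le> (E * (\<bar>a\<bar> + \<bar>b * c\<bar> * (2 * S \<omega>))) * (s - 0)"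
    proof (rule integral_bound)
      show "continuous_on {0..s} (\<lambda>r. exp (- b * r) * g r \<omega>)"
        by (rule continuous_on_subset[OF g_cont[OF \<omega>]]) (use s in auto)
      show "norm (exp (- b * r) * g r \<omega>) \<le> E * (\<bar>a\<bar> + \<bar>b * c\<bar> * (2 * S \<omega>))" if "r \<in> {0..s}" for r
      proof -
        have r: "r \<in> {0..T}" using that s by auto
        show ?thesis
          unfolding real_norm_def abs_mult[of "exp (- b * r)"] abs_exp_cancel
          using exp_le[of "- b * r"] b_le[OF r] g_le[OF r] E0 by (intro mult_mono) auto
      qed
    qed (use s in auto)
    also have "\<dots> \<le> (E * (\<bar>a\<bar> + \<bar>b * c\<bar> * (2 * S \<omega>))) * T"
      using s E0 S(2)[of \<omega>] by (intro mult_left_mono) auto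
    finally have "\<bar>exp (b * s) * integral {0..s} (\<lambda>r. exp (- b * r) * g r \<omega>)\<bar>
        \<le> E * ((E * (\<bar>a\<bar> + \<bar>b * c\<bar> * (2 * S \<omega>))) * T)"
      unfolding real_norm_def abs_mult[of "exp (b * s)"] abs_exp_cancel
      using exp_le[OF b_le[OF s]] E0 by (intro mult_mono) auto
    moreover have "\<bar>c * (W' s \<omega> - W' 0 \<omega>)\<bar> \<le> \<bar>c\<bar> * (2 * S \<omega>)"
      unfolding abs_mult by (intro mult_left_mono diff s) simp
    ultimately have "\<bar>U s \<omega>\<bar> \<le> E * ((E * (\<bar>a\<bar> + \<bar>b * c\<bar> * (2 * S \<omega>))) * T) + \<bar>c\<bar> * (2 * S \<omega>)"
      unfolding U_def by (rule order_trans[OF abs_triangle_ineq add_mono])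
    also have "\<dots> = \<alpha> + \<beta> * S \<omega>" unfolding \<alpha>_def \<beta>_def by (simp add: algebra_simps)
    finally show ?thesis .
  qed
  \<comment> \<open>The null set may depend on t and x, which is harmless because each expectation
    involves a single pair.\<close>
  have flow: "AE \<omega> in M. \<forall>s\<in>{t..T}. X t x s \<omega> = U s \<omega> + exp (b * (s - t)) * (x - U t \<omega>)"
    if t: "t \<in> {0..T}" for t x
  proof -
    have 0: "(0::real) \<in> {0..T}" using T_pos by simp
    show ?thesis
      using X_sol[OF t, of x] X_sol[OF 0, of 0] AE_not_in[OF N(1)] AE_space
    proof eventually_elim
      case (elim \<omega>)
      have W'_eq: "W' r \<omega> = W r \<omega>" for r using elim(3) by (simp add: W'_def)
      have X0: "continuous_on {0..T} (\<lambda>s. X 0 0 s \<omega>)" and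
        X0_eq: "\<And>s. s \<in> {0..T} \<Longrightarrow> X 0 0 s \<omega> = integral {0..s} (\<lambda>r. a + b * X 0 0 r \<omega>) + c * (W s \<omega> - W 0 \<omega>)"
        using elim(2) by auto
      have Xt: "continuous_on {t..T} (\<lambda>s. X t x s \<omega>)" and
        Xt_eq: "\<And>s. s \<in> {t..T} \<Longrightarrow> X t x s \<omega> = x + integral {t..s} (\<lambda>r. a + b * X t x r \<omega>) + c * (W s \<omega> - W t \<omega>)"
        using elim(1) by auto
      have W_cont: "continuous_on {0..T} (\<lambda>s. W s \<omega>)" using W'_cont[OF elim(4)] by (simp add: W'_eq)
      have U_eq: "X 0 0 s \<omega> = U s \<omega>" if s: "s \<in> {0..T}" for s
      proof -
        have "X 0 0 s \<omega> - c * (W s \<omega> - W 0 \<omega>)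
            = exp (b * (s - 0)) * (0 + integral {0..s} (\<lambda>r. exp (- b * (r - 0)) * g r \<omega>))"
        proof (rule variation_of_constants[OF _ _ _ s, where y="\<lambda>s. X 0 0 s \<omega> - c * (W s \<omega> - W 0 \<omega>)"])
          show "continuous_on {0..T} (\<lambda>s. X 0 0 s \<omega> - c * (W s \<omega> - W 0 \<omega>))"
            by (intro continuous_intros X0 W_cont)
          show "continuous_on {0..T} (\<lambda>r. g r \<omega>)"
            unfolding g_def by (intro continuous_intros W'_cont elim(4))
          fix s assume s: "s \<in> {0..T}"
          have "(\<lambda>r. g r \<omega> + b * (X 0 0 r \<omega> - c * (W r \<omega> - W 0 \<omega>))) = (\<lambda>r. a + b * X 0 0 r \<omega>)"
            by (simp add: g_def W'_eq fun_eq_iff algebra_simps)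
          then show "X 0 0 s \<omega> - c * (W s \<omega> - W 0 \<omega>)
              = 0 + integral {0..s} (\<lambda>r. g r \<omega> + b * (X 0 0 r \<omega> - c * (W r \<omega> - W 0 \<omega>)))"
            using X0_eq[OF s] by simp
        qed
        then show ?thesis by (simp add: U_def W'_eq algebra_simps)
      qed
      show ?case
      proof
        fix s assume s: "s \<in> {t..T}"
        \<comment> \<open>In the difference of two solutions both the noise and the constant drift
          cancel, which leaves a homogeneous linear equation.\<close>
        have "X t x s \<omega> - X 0 0 s \<omega>
            = exp (b * (s - t)) * ((x - X 0 0 t \<omega>) + integral {t..s} (\<lambda>r. exp (- b * (r - t)) * 0))"
        proof (rule variation_of_constants[OF _ _ _ s, where y="\<lambda>s. X t x s \<omega> - X 0 0 s \<omega>"])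
          have X0t: "continuous_on {t..T} (\<lambda>s. X 0 0 s \<omega>)"
            by (rule continuous_on_subset[OF X0]) (use t in auto)
          show "continuous_on {t..T} (\<lambda>s. X t x s \<omega> - X 0 0 s \<omega>)"
            by (intro continuous_intros Xt X0t)
          fix s assume s: "s \<in> {t..T}"
          have s0: "s \<in> {0..T}" using s t by auto
          have sub: "{t..s} \<subseteq> {t..T}" "{0..s} \<subseteq> {0..T}" using s t by auto
          have i1: "(\<lambda>r. a + b * X t x r \<omega>) integrable_on {t..s}"
            by (intro integrable_continuous_interval continuous_intros continuous_on_subset[OF Xt sub(1)])
          have i2: "(\<lambda>r. a + b * X 0 0 r \<omega>) integrable_on {t..s}"
            by (intro integrable_continuous_interval continuous_intros continuous_on_subset[OF X0t sub(1)])
          have i3: "(\<lambda>r. a + b * X 0 0 r \<omega>) integrable_on {0..s}"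
            by (intro integrable_continuous_interval continuous_intros continuous_on_subset[OF X0 sub(2)])
          have split: "integral {0..t} (\<lambda>r. a + b * X 0 0 r \<omega>) + integral {t..s} (\<lambda>r. a + b * X 0 0 r \<omega>)
              = integral {0..s} (\<lambda>r. a + b * X 0 0 r \<omega>)"
            using s t i3 by (intro Henstock_Kurzweil_Integration.integral_combine) auto
          have "integral {t..s} (\<lambda>r. 0 + b * (X t x r \<omega> - X 0 0 r \<omega>))
              = integral {t..s} (\<lambda>r. (a + b * X t x r \<omega>) - (a + b * X 0 0 r \<omega>))"
            by (simp add: algebra_simps)
          also have "\<dots> = integral {t..s} (\<lambda>r. a + b * X t x r \<omega>) - integral {t..s} (\<lambda>r. a + b * X 0 0 r \<omega>)"
            by (rule Henstock_Kurzweil_Integration.integral_diff[OF i1 i2])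
          finally show "X t x s \<omega> - X 0 0 s \<omega>
              = (x - X 0 0 t \<omega>) + integral {t..s} (\<lambda>r. 0 + b * (X t x r \<omega> - X 0 0 r \<omega>))"
            using Xt_eq[OF s] X0_eq[OF s0] X0_eq[OF t] split by (simp add: algebra_simps)
        qed simp
        moreover have "s \<in> {0..T}" using s t by auto
        ultimately show "X t x s \<omega> = U s \<omega> + exp (b * (s - t)) * (x - U t \<omega>)"
          using U_eq t by simp
      qed
    qed
  qed

  \<comment> \<open>Passage from the given solutions to the Gaussian functional\<close>
  have negl1: "negligible_dfact p1" unfolding p1_def by (intro negligible_dfact_mult negl)
  interpret gaussian_functional M U "\<lambda>\<omega>. \<alpha> + \<beta> * S \<omega>" b T u1 u2 u3 "v T" p1 p2 p3 q
  proof
    show "(\<lambda>\<omega>. \<alpha> + \<beta> * S \<omega>) \<in> borel_measurable M" using S(1) by measurable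
    show "integrable M (\<lambda>\<omega>. ps_abs_eval h (\<alpha> + \<beta> * S \<omega>))" if h: "negligible_dfact h" for h
    proof (rule integrable_ps_abs_eval[OF h])
      show "integrable M (\<lambda>\<omega>. (\<alpha> + \<beta> * S \<omega>) ^ k)"
        "(\<integral>\<omega>. (\<alpha> + \<beta> * S \<omega>) ^ k \<partial>M) \<le> 3 * ((2 * (\<alpha> + \<beta> * sqrt T)) ^ k * real (dfact (k - 1)))" for k
        using affine_moment_le[OF prob_space_axioms S(2,1,4,5) nonneg, of k] T_pos by auto
    qed (use nonneg S(2) T_pos in auto)
    \<comment> \<open>The series \<open>p1\<close> evaluates to the square of
      \<open>ps_eval p y\<close>, so the first term has real part at most 0; the other two are
      imaginary.\<close>
    show "Re (u1 s * complex_of_real (ps_eval p1 y) + u2 s * complex_of_real (ps_eval p2 y)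
        + u3 s * complex_of_real (ps_eval p3 y)) \<le> 0" if "s \<in> {0..T}" for s y
      using re0[OF that] re_u1[OF that]
      by (simp add: p1_def ps_eval_mult[OF negl(1,1)] mult_nonpos_nonneg)
    show "Re (v T * complex_of_real (ps_eval q y)) \<le> 0" for y
      using re0[of T] T_pos by simp
  qed (use T_pos U_cont U_meas U_le cont negl negl1 in auto)
  note null = usual_filtration_complete[OF brownian_motionD(2)[OF BM]]
  have "f t x = expect (\<lambda>t x \<omega>. 1) t x" if t: "t \<in> {0..T}" for t x
  proof -
    let ?I = "\<lambda>\<omega>. exp (integral {t..T} (\<lambda>s. u1 s * complex_of_real (ps_eval p1 (X t x s \<omega>))
        + u2 s * complex_of_real (ps_eval p2 (X t x s \<omega>)) + u3 s * complex_of_real (ps_eval p3 (X t x s \<omega>)))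
      + v T * complex_of_real (ps_eval q (X t x T \<omega>)))"
    have meas: "(\<lambda>\<omega>. exp (exponent 0 t x \<omega>) * 1) \<in> borel_measurable M"
      using weighted_measurable[OF exponent_poly.one t, of x] .
    have eq: "AE \<omega> in M. ?I \<omega> = exp (exponent 0 t x \<omega>) * 1"
      using flow[OF t, of x] AE_space
    proof eventually_elim
      case (elim \<omega>)
      have *: "X t x s \<omega> = flow t x s \<omega>" if "s \<in> {t..T}" for s
        using elim(1) that by (simp add: flow_def)
      have "integral {t..T} (\<lambda>s. u1 s * complex_of_real (ps_eval p1 (X t x s \<omega>))
          + u2 s * complex_of_real (ps_eval p2 (X t x s \<omega>)) + u3 s * complex_of_real (ps_eval p3 (X t x s \<omega>)))
        = integral {t..T} (\<lambda>s. u1 s * complex_of_real (ps_eval p1 (flow t x s \<omega>))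
          + u2 s * complex_of_real (ps_eval p2 (flow t x s \<omega>)) + u3 s * complex_of_real (ps_eval p3 (flow t x s \<omega>)))"
        by (intro Henstock_Kurzweil_Integration.integral_cong) (simp add: *)
      moreover have "X t x T \<omega> = flow t x T \<omega>" using * t by auto
      ultimately show ?case using exponent_0_eq[OF t elim(2), of x] by simp
    qed
    show ?thesis
      unfolding f_def expect_def
      by (rule integral_cong_AE[OF borel_measurable_AE_eq_complete[OF null meas eq] meas eq])
  qed
  then show ?thesis using smooth_expectation by blast
qed

end
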